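(* Let $g$ be a finite-order symplectic automorphism of a K3 surface belonging to one of the classes 2A, 3A, 4B, 5A, 6A, 7AB, 8A, with fixed-point data as listed in the context. Then the twined complex Hodge-Elliptic genus is $$ \mathsf{H\text{-}Ell}_g(\tau,z,\nu)=\frac1{12}\chi_g(\mathrm{K3})\,\varphi_{0,1}(\tau,z)+\tilde T_g(\tau)\,\varphi_{-2,1}(\tau,z)-\left(1-\frac12\left(u+\frac1u\right)\right)\mathsf{Flat}(\tau,z), $$ where $$ \mathsf{Flat}(\tau,z)=4\,\frac{\theta_1(\tau,z)^2}{\eta(\tau)^3}\,\mu(\tau,z)+\frac{\theta_1(\tau,z)^2}{\eta(\tau)^6}\left[\frac{2\,(1+2q+6q^2+2q^3+q^4)}{(q-1)(q+1)(1+q+q^2)}+8F_2^{(2)}(\tau)\right] $$ and $\chi_g(\mathrm{K3})$ (the number of fixed points) and $\tilde T_g(\tau)$ are given in the table of the context.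
   Context: Notation: $q=e^{2\pi i\tau}$ with $\operatorname{Im}\tau>0$, $y=e^{2\pi iz}$, $u=e^{2\pi i\nu}$, $y^{1/2}=e^{\pi iz}$, $\zeta_m=e^{2\pi i/m}$. Special functions: $\theta_1(\tau,z)=i q^{1/8}y^{-1/2}\prod_{n\ge1}(1-q^n)(1-q^{n-1}y)(1-q^ny^{-1})$; $\eta(\tau)=q^{1/24}\prod_{n\ge1}(1-q^n)$; $\mu(\tau,z)=\frac{-i y^{1/2}}{\theta_1(\tau,z)}\sum_{\ell\in\mathbb Z}\frac{(-1)^\ell y^\ell q^{\ell(\ell+1)/2}}{1-yq^\ell}$; $E_2(\tau)=1-24\sum_{n\ge1}\frac{nq^n}{1-q^n}$; $F_2^{(2)}(\tau)=\sum_{r>s>0,\ r-s\equiv1\ (\mathrm{mod}\ 2)}(-1)^rq^{rs/2}$; $\Lambda_N(\tau)=\frac N{24}\left(NE_2(N\tau)-E_2(\tau)\right)$; $\varphi_{-2,1}=-\theta_1^2/\eta^6$; $\varphi_{0,1}=\frac12\frac{\theta_1^2}{\eta^3}\left[24\mu+\frac{-2E_2+48F_2^{(2)}}{\eta^3}\right]$ (the weak Jacobi form of weight 0, index 1 with $q^0$-term $y+10+y^{-1}$). Table (class; eigenvalue pairs $(\lambda,\lambda^{-1})$ of $g$ on the tangent spaces at its fixed points; $\chi_g(\mathrm{K3})$; $\tilde T_g$): 2A: $8\times(-1,-1)$; 8; $16\Lambda_2$. 3A: $6\times(\zeta_3,\zeta_3^{-1})$; 6; $6\Lambda_3$. 4B: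 $4\times(i,-i)$; 4; $4(-\Lambda_2+\Lambda_4)$. 5A: $2\times(\zeta_5,\zeta_5^{-1})$ and $2\times(\zeta_5^2,\zeta_5^{-2})$; 4; $2\Lambda_5$. 6A: $2\times(\zeta_6,\zeta_6^{-1})$; 2; $2(-\Lambda_2-\Lambda_3+\Lambda_6)$. 7AB: $(\zeta_7,\zeta_7^{-1}),(\zeta_7^2,\zeta_7^{-2}),(\zeta_7^3,\zeta_7^{-3})$; 3; $\Lambda_7$. 8A: $(\zeta_8,\zeta_8^{-1}),(\zeta_8^3,\zeta_8^{-3})$; 2; $-\Lambda_4+\Lambda_8$. Definitions: for $N\ge0$ let $s_N(\tau,z)=\frac{\theta_1(\tau,z)}{\eta(\tau)^3}\sum_{i\in\mathbb Z}\frac1{(1-yq^i)(1-\frac1yq^{N-1-i})}$, $\mathscr F_N=-\frac{\theta_1}{\eta^3}\left(s_N-2s_{N+1}+2s_{N+3}-s_{N+4}\right)$, and $\chi_N(\lambda)=\sum_{i=0}^N\lambda^{2i-N}$. With the sum over $\lambda_i$ running over the fixed points (one $\lambda_i$ from each eigenvalue pair), the twined elliptic genus is $$\mathsf{Ell}_g(\tau,z)=\sum_{N=0}^\infty\mathscr F_N(\tau,z)\sum_{\lambda_i}\frac{\chi_N(\lambda_i)}{(1-\lambda_i)(1-\lambda_i^{-1})},$$ the equivariant Euler characteristic of the structure sheaf is $\chi_g(\mathcal O)=\sum_{\lambda_i}\frac1{(1-\lambda_i)(1-\lambda_i^{-1})}$, and the twined complex Hodge-Elliptic genus is defined by $$\mathsf{H\text{-}Ell}_g(\tau,z,\nu)=\mathsf{Ell}_g(\tau,z)-\left[1-\frac12\left(u+\frac1u\right)\right]\mathscr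 F_0(\tau,z)\,\chi_g(\mathcal O).$$
   Formalization: F_2^{(2)} is taken as the sum of (-1)^r s q^{rs/2}, with a factor s missing from the printed definition; without it the formula fails (q^3 coefficient 0 instead of -1, e.g. at u=1) and φ_{0,1} is not the stated weak Jacobi form. *)

theory Defs
  imports "HOL-Analysis.Analysis" "HOL-Library.Multiset"
begin

section \<open>Complex surfaces, K3 surfaces and symplectic automorphisms\<close>

text \<open>
  A surface is a subset \<open>X\<close> of a Hausdorff space together with an atlas: a set of charts
  \<open>(U, \<phi>)\<close> with values in \<open>complex^2\<close>.  A map between open subsets of \<open>complex^2\<close> is holomorphic iff
  its real Frechet derivative exists and is complex linear at every point, that is, given by a
  complex 2-by-2 matrix.
\<close>

type_synonym 'a chart = "'a set \<times> ('a \<Rightarrow> complex^2)"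

definition has_jacobian :: "(complex^2 \<Rightarrow> complex^2) \<Rightarrow> complex^2^2 \<Rightarrow> complex^2 \<Rightarrow> bool" where
  "has_jacobian F A x \<longleftrightarrow> (F has_derivative (\<lambda>v. A *v v)) (at x)"

definition in_charts :: "'a chart \<Rightarrow> 'a chart \<Rightarrow> ('a \<Rightarrow> 'a) \<Rightarrow> complex^2 \<Rightarrow> complex^2" where
  "in_charts c d g = snd d \<circ> g \<circ> inv_into (fst c) (snd c)"

definition holomorphic_map :: "'a::t2_space set \<Rightarrow> 'a chart set \<Rightarrow> ('a \<Rightarrow> 'a) \<Rightarrow> bool" where
  "holomorphic_map X \<A> g \<longleftrightarrow>
     continuous_on X g \<and> g ` X \<subseteq> X \<and>
     (\<forall>c\<in>\<A>. \<forall>d\<in>\<A>. \<forall>x\<in>fst c. g x \<in> fst d \<longrightarrow>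
        (\<exists>A. has_jacobian (in_charts c d g) A (snd c x)))"

text \<open>The last conjunct says that all transition maps are holomorphic.\<close>

definition complex_surface :: "'a::t2_space set \<Rightarrow> 'a chart set \<Rightarrow> bool" where
  "complex_surface X \<A> \<longleftrightarrow>
     (\<Union>c\<in>\<A>. fst c) = X \<and>
     (\<forall>(U, \<phi>)\<in>\<A>. openin (top_of_set X) U \<and> open (\<phi> ` U) \<and>
        homeomorphism U (\<phi> ` U) \<phi> (inv_into U \<phi>)) \<and>
     holomorphic_map X \<A> id"

text \<open>
  A two-form is given by its coefficient functions: \<open>w c\<close> is the coefficient of
  \<open>dx\<^sub>1 \<and> dx\<^sub>2\<close> in the chart \<open>c\<close>.  The condition
  \<open>preserves_two_form \<A> g w\<close> is \<open>g\<^sup>* w = w\<close>; for \<open>g = id\<close> it is the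
  transformation law of the coefficients under a change of charts.
\<close>

definition preserves_two_form ::
    "'a chart set \<Rightarrow> ('a \<Rightarrow> 'a) \<Rightarrow> ('a chart \<Rightarrow> complex^2 \<Rightarrow> complex) \<Rightarrow> bool" where
  "preserves_two_form \<A> g w \<longleftrightarrow>
     (\<forall>c\<in>\<A>. \<forall>d\<in>\<A>. \<forall>x\<in>fst c. g x \<in> fst d \<longrightarrow>
        (\<forall>A. has_jacobian (in_charts c d g) A (snd c x) \<longrightarrow>
           w c (snd c x) = w d (snd d (g x)) * det A))"

definition holomorphic_two_form ::
    "'a chart set \<Rightarrow> ('a chart \<Rightarrow> complex^2 \<Rightarrow> complex) \<Rightarrow> bool" where
  "holomorphic_two_form \<A> w \<longleftrightarrow>
     (\<forall>c\<in>\<A>. \<forall>x\<in>fst c. \<exists>b::complex^2.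
        (w c has_derivative (\<lambda>v. \<Sum>i\<in>UNIV. b $ i * v $ i)) (at (snd c x))) \<and>
     preserves_two_form \<A> id w"

definition K3_surface :: "'a::t2_space set \<Rightarrow> 'a chart set \<Rightarrow> bool" where
  "K3_surface X \<A> \<longleftrightarrow>
     complex_surface X \<A> \<and> X \<noteq> {} \<and> compact X \<and> connected X \<and> simply_connected X \<and>
     (\<exists>w. holomorphic_two_form \<A> w \<and> (\<forall>c\<in>\<A>. \<forall>x\<in>fst c. w c (snd c x) \<noteq> 0))"

definition symplectic_automorphism :: "'a::t2_space set \<Rightarrow> 'a chart set \<Rightarrow> ('a \<Rightarrow> 'a) \<Rightarrow> bool" where
  "symplectic_automorphism X \<A> g \<longleftrightarrow>
     bij_betw g X X \<and> holomorphic_map X \<A> g \<and> holomorphic_map X \<A> (inv_into X g) \<and>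
     (\<forall>w. holomorphic_two_form \<A> w \<longrightarrow> preserves_two_form \<A> g w)"

definition has_order :: "'a set \<Rightarrow> ('a \<Rightarrow> 'a) \<Rightarrow> nat \<Rightarrow> bool" where
  "has_order X g n \<longleftrightarrow>
     0 < n \<and> (\<forall>x\<in>X. (g ^^ n) x = x) \<and> (\<forall>m. 0 < m \<and> m < n \<longrightarrow> (\<exists>x\<in>X. (g ^^ m) x \<noteq> x))"

definition fixed_points :: "'a set \<Rightarrow> ('a \<Rightarrow> 'a) \<Rightarrow> 'a set" where
  "fixed_points X g = {p \<in> X. g p = p}"

text \<open>
  At a fixed point \<open>p\<close>, the numbers \<open>a\<close>, \<open>b\<close> are the eigenvalues, with multiplicity, of \<open>g\<close> acting on
  the tangent space: the roots of the characteristic polynomial of the Jacobian of \<open>g\<close> in a chart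
  around \<open>p\<close>.
\<close>

definition tangent_eigenvalues ::
    "'a chart set \<Rightarrow> ('a \<Rightarrow> 'a) \<Rightarrow> 'a \<Rightarrow> complex \<Rightarrow> complex \<Rightarrow> bool" where
  "tangent_eigenvalues \<A> g p a b \<longleftrightarrow>
     (\<exists>c\<in>\<A>. p \<in> fst c \<and>
        (\<exists>A. has_jacobian (in_charts c c g) A (snd c p) \<and>
           (\<forall>t. det (mat t - A) = (t - a) * (t - b))))"


section \<open>The classes and their data\<close>

datatype aut_class = C2A | C3A | C4B | C5A | C6A | C7AB | C8A

primrec class_order :: "aut_class \<Rightarrow> nat" where
  "class_order C2A = 2"
| "class_order C3A = 3"
| "class_order C4B = 4"
| "class_order C5A = 5"
| "class_order C6A = 6"
| "class_order C7AB = 7"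
| "class_order C8A = 8"

definition zeta :: "nat \<Rightarrow> complex" where
  "zeta m = exp (2 * of_real pi * \<i> / of_nat m)"

definition eigenpair :: "complex \<Rightarrow> complex multiset" where
  "eigenpair l = {#l, inverse l#}"

text \<open>Eigenvalue pairs are unordered, hence multisets of size two.\<close>

primrec eigenvalue_table :: "aut_class \<Rightarrow> complex multiset multiset" where
  "eigenvalue_table C2A = replicate_mset 8 (eigenpair (-1))"
| "eigenvalue_table C3A = replicate_mset 6 (eigenpair (zeta 3))"
| "eigenvalue_table C4B = replicate_mset 4 (eigenpair \<i>)"
| "eigenvalue_table C5A =
     replicate_mset 2 (eigenpair (zeta 5)) + replicate_mset 2 (eigenpair (zeta 5 ^ 2))"
| "eigenvalue_table C6A = replicate_mset 2 (eigenpair (zeta 6))"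
| "eigenvalue_table C7AB =
     {#eigenpair (zeta 7), eigenpair (zeta 7 ^ 2), eigenpair (zeta 7 ^ 3)#}"
| "eigenvalue_table C8A = {#eigenpair (zeta 8), eigenpair (zeta 8 ^ 3)#}"

primrec chi_K3 :: "aut_class \<Rightarrow> nat" where
  "chi_K3 C2A = 8"
| "chi_K3 C3A = 6"
| "chi_K3 C4B = 4"
| "chi_K3 C5A = 4"
| "chi_K3 C6A = 2"
| "chi_K3 C7AB = 3"
| "chi_K3 C8A = 2"

lemma size_eigenvalue_table: "size (eigenvalue_table c) = chi_K3 c"
  by (cases c) simp_all

text \<open>
  The function \<open>ev\<close> chooses one eigenvalue from the pair at each fixed point; every choice is allowed.
\<close>

definition has_fixed_point_data ::
    "'a set \<Rightarrow> 'a chart set \<Rightarrow> ('a \<Rightarrow> 'a) \<Rightarrow> ('a \<Rightarrow> complex) \<Rightarrow> aut_class \<Rightarrow> bool" where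
  "has_fixed_point_data X \<A> g ev c \<longleftrightarrow>
     finite (fixed_points X g) \<and>
     (\<forall>p\<in>fixed_points X g. tangent_eigenvalues \<A> g p (ev p) (inverse (ev p))) \<and>
     image_mset (\<lambda>p. eigenpair (ev p)) (mset_set (fixed_points X g)) = eigenvalue_table c"


section \<open>Special functions\<close>

text \<open>
  The exponential \<open>ee x\<close> gives \<open>q = ee \<tau>\<close>, \<open>y = ee z\<close>, \<open>u = ee \<nu>\<close>, and fixes the branches of the
  fractional powers: \<open>q\<close> to the power \<open>a\<close> is \<open>ee (a * \<tau>)\<close>.
\<close>

definition ee :: "complex \<Rightarrow> complex" where
  "ee x = exp (2 * of_real pi * \<i> * x)"

definition theta1 :: "complex \<Rightarrow> complex \<Rightarrow> complex" where
  "theta1 \<tau> z = \<i> * ee (\<tau> / 8) * ee (- z / 2) *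
     (\<Prod>n. (1 - ee \<tau> ^ Suc n) * (1 - ee \<tau> ^ n * ee z) * (1 - ee \<tau> ^ Suc n * inverse (ee z)))"

definition eta :: "complex \<Rightarrow> complex" where
  "eta \<tau> = ee (\<tau> / 24) * (\<Prod>n. 1 - ee \<tau> ^ Suc n)"

definition mu :: "complex \<Rightarrow> complex \<Rightarrow> complex" where
  "mu \<tau> z = (- \<i> * ee (z / 2)) / theta1 \<tau> z *
     (\<Sum>\<^sub>\<infinity>l\<in>(UNIV::int set). (-1) powi l * ee z powi l * ee \<tau> powi (l * (l + 1) div 2) /
        (1 - ee z * ee \<tau> powi l))"

definition E2 :: "complex \<Rightarrow> complex" where
  "E2 \<tau> = 1 - 24 * (\<Sum>n. of_nat (Suc n) * ee \<tau> ^ Suc n / (1 - ee \<tau> ^ Suc n))"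

text \<open>
  The summand carries the factor \<open>s\<close>, as in the umbral moonshine literature (Cheng, Duncan and
  Harvey): \<open>F22 = q + q^2 - q^3 + q^4 + \<dots>\<close>.  Without this factor the function \<open>phi01\<close> below
  would differ from the weak Jacobi form of weight 0 and index 1, from the coefficient of \<open>q^3\<close> of
  this series on.  The exponent \<open>r * s / 2\<close> is an integer, since one of \<open>r\<close>, \<open>s\<close> is even.
\<close>

definition F22 :: "complex \<Rightarrow> complex" where
  "F22 \<tau> = (\<Sum>\<^sub>\<infinity>(r, s)\<in>{(r, s). r > s \<and> s > 0 \<and> odd (r - s)}.
     (-1) ^ r * of_nat s * ee \<tau> ^ (r * s div 2))"

definition Lam :: "nat \<Rightarrow> complex \<Rightarrow> complex" where
  "Lam N \<tau> = of_nat N / 24 * (of_nat N * E2 (of_nat N * \<tau>) - E2 \<tau>)"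

definition phi_m21 :: "complex \<Rightarrow> complex \<Rightarrow> complex" where
  "phi_m21 \<tau> z = - (theta1 \<tau> z ^ 2 / eta \<tau> ^ 6)"

definition phi01 :: "complex \<Rightarrow> complex \<Rightarrow> complex" where
  "phi01 \<tau> z = 1 / 2 * (theta1 \<tau> z ^ 2 / eta \<tau> ^ 3) *
     (24 * mu \<tau> z + (-2 * E2 \<tau> + 48 * F22 \<tau>) / eta \<tau> ^ 3)"

primrec T_tilde :: "aut_class \<Rightarrow> complex \<Rightarrow> complex" where
  "T_tilde C2A = (\<lambda>\<tau>. 16 * Lam 2 \<tau>)"
| "T_tilde C3A = (\<lambda>\<tau>. 6 * Lam 3 \<tau>)"
| "T_tilde C4B = (\<lambda>\<tau>. 4 * (- Lam 2 \<tau> + Lam 4 \<tau>))"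
| "T_tilde C5A = (\<lambda>\<tau>. 2 * Lam 5 \<tau>)"
| "T_tilde C6A = (\<lambda>\<tau>. 2 * (- Lam 2 \<tau> - Lam 3 \<tau> + Lam 6 \<tau>))"
| "T_tilde C7AB = (\<lambda>\<tau>. Lam 7 \<tau>)"
| "T_tilde C8A = (\<lambda>\<tau>. - Lam 4 \<tau> + Lam 8 \<tau>)"


section \<open>Twined genera\<close>

definition s_fun :: "nat \<Rightarrow> complex \<Rightarrow> complex \<Rightarrow> complex" where
  "s_fun N \<tau> z = theta1 \<tau> z / eta \<tau> ^ 3 *
     (\<Sum>\<^sub>\<infinity>i\<in>(UNIV::int set).
        1 / ((1 - ee z * ee \<tau> powi i) * (1 - 1 / ee z * ee \<tau> powi (int N - 1 - i))))"

definition scriptF :: "nat \<Rightarrow> complex \<Rightarrow> complex \<Rightarrow> complex" where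
  "scriptF N \<tau> z = - (theta1 \<tau> z / eta \<tau> ^ 3) *
     (s_fun N \<tau> z - 2 * s_fun (N + 1) \<tau> z + 2 * s_fun (N + 3) \<tau> z - s_fun (N + 4) \<tau> z)"

definition chi_char :: "nat \<Rightarrow> complex \<Rightarrow> complex" where
  "chi_char N l = (\<Sum>i=0..N. l powi (2 * int i - int N))"

text \<open>In the following, \<open>P\<close> is the set of fixed points and \<open>ev\<close> the choice of eigenvalues.\<close>

definition twined_Ell :: "'a set \<Rightarrow> ('a \<Rightarrow> complex) \<Rightarrow> complex \<Rightarrow> complex \<Rightarrow> complex" where
  "twined_Ell P ev \<tau> z =
     (\<Sum>N. scriptF N \<tau> z *
        (\<Sum>p\<in>P. chi_char N (ev p) / ((1 - ev p) * (1 - inverse (ev p)))))"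

definition chi_structure_sheaf :: "'a set \<Rightarrow> ('a \<Rightarrow> complex) \<Rightarrow> complex" where
  "chi_structure_sheaf P ev = (\<Sum>p\<in>P. 1 / ((1 - ev p) * (1 - inverse (ev p))))"

definition twined_HEll ::
    "'a set \<Rightarrow> ('a \<Rightarrow> complex) \<Rightarrow> complex \<Rightarrow> complex \<Rightarrow> complex \<Rightarrow> complex" where
  "twined_HEll P ev \<tau> z \<nu> =
     twined_Ell P ev \<tau> z -
     (1 - 1 / 2 * (ee \<nu> + 1 / ee \<nu>)) * scriptF 0 \<tau> z * chi_structure_sheaf P ev"

definition Flat :: "complex \<Rightarrow> complex \<Rightarrow> complex" where
  "Flat \<tau> z = (let q = ee \<tau> in
     4 * (theta1 \<tau> z ^ 2 / eta \<tau> ^ 3) * mu \<tau> z +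
     theta1 \<tau> z ^ 2 / eta \<tau> ^ 6 *
       (2 * (1 + 2 * q + 6 * q ^ 2 + 2 * q ^ 3 + q ^ 4) / ((q - 1) * (q + 1) * (1 + q + q ^ 2))
        + 8 * F22 \<tau>))"

end

(*
  Write q = e(tau), y = e(z) and S_N for the sum over i in s_N.  Partial fractions make S_N
  telescope to (N-1)/(1-q^(N-1)) for N <> 1, so only S_1 depends on z.  For a root of unity l
  the second differences of chi_N(l) cancel the denominator (1-l)(1-1/l), and summation by parts gives
    sum_N F_N chi_N(l) / ((1-l)(1-1/l))
      = phi_{-2,1} * (1 / ((1-l)(1-1/l)) - S_1 - sum_m (l^m + l^(-m)) m q^m / (1-q^m)).
  Adding up over the fixed points, the power sums of the eigenvalues are divisibility indicators,
  and Lambda_N is a series of the same kind, with support on the m not divisible by N.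

  What remains is S_1 = eta^3 mu + 2 F_2^(2).  Put c_j = (-1)^j q^(j(j-1)/2), let P = sum_j c_j x^j be
  the triple product and V(x) = x P(x) / (1-x)^2 - (q;q)^3 x / (1-x).  By the triple product and its
  derivative at 1, V has no pole: V(x) = sum_j c_j (x^(j+1) - x + j x (1-x)) / (1-x)^2.  Since
  c_i y^i P(y q^i) = P(y), the difference of P(y) S_1 and the Appell-Lerch sum is, up to sign,
  sum_i c_i y^i V(y q^i).  Expanding V and using c_i c_n q^(in) = c_(i+n), this sum
  factors as P(y) times a double series in q alone, and that series is -2 F_2^(2).
*)

theory Submission
  imports Defs
begin

section \<open>Infinite sums\<close>

text \<open>The obstacle is growth: on the unit circle \<open>chi_char N l\<close> grows linearly in
  N, and so does the sum over i in \<open>s_fun\<close>. The four-term combination in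
  \<open>scriptF\<close> annihilates this linear part, so from N = 2 on only the terms m q^m / (1 -
  q^m) survive, which decay geometrically. The exceptional indices N = 0 and N = 1 produce the
  dependence on z and the constant. The rational function in \<open>Flat\<close> is, up to the
  factor -2, the z-independent part of the term N = 0 over a common denominator, and
  \<open>Flat\<close> is twice \<open>scriptF 0\<close> because the equivariant Euler characteristic
  is 2 for every class. All functions of an eigenvalue that are summed over the fixed points are
  invariant under inversion, so the choice made by \<open>ev\<close> drops out.\<close>

lemma norm_summable_on_int:
  fixes f :: "int \<Rightarrow> 'b::banach"
  assumes "summable (\<lambda>n. norm (f (int n)))" "summable (\<lambda>n. norm (f (- int n)))"
  shows "(\<lambda>j. norm (f j)) summable_on UNIV"
proof -
  have "(\<lambda>j. norm (f j)) summable_on (range int)"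
    using norm_summable_imp_summable_on[of "\<lambda>n. norm (f (int n))"] assms(1)
    by (subst summable_on_reindex) (auto simp: o_def)
  moreover have "(\<lambda>j. norm (f j)) summable_on (range (\<lambda>n. - int n))"
    using norm_summable_imp_summable_on[of "\<lambda>n. norm (f (- int n))"] assms(2)
    by (subst summable_on_reindex) (auto simp: o_def inj_on_def)
  ultimately have "(\<lambda>j. norm (f j)) summable_on (range int \<union> range (\<lambda>n. - int n))"
    by (rule summable_on_union)
  moreover have "range int \<union> range (\<lambda>n. - int n) = UNIV"
    by (auto simp: image_iff) (metis int_cases2)
  ultimately show ?thesis by simp
qed

text \<open>Tannery's theorem, read off from dominated convergence for the counting measure. It
  carries the finite triple products to the infinite series.\<close>

lemma has_sum_dominated_convergence:
  fixes f :: "nat \<Rightarrow> 'a \<Rightarrow> 'b::{banach, second_countable_topology}"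
  assumes f: "\<And>n. (f n has_sum s n) A"
    and g: "g summable_on A"
    and bound: "\<And>n x. x \<in> A \<Longrightarrow> norm (f n x) \<le> g x"
    and lim: "\<And>x. x \<in> A \<Longrightarrow> (\<lambda>n. f n x) \<longlonglongrightarrow> h x"
    and s: "s \<longlonglongrightarrow> S"
  shows "(h has_sum S) A"
proof -
  have h_bound: "norm (h x) \<le> g x" if "x \<in> A" for x
    by (rule Lim_bounded[OF tendsto_norm[OF lim[OF that]]]) (use bound that in auto)
  have fa: "(\<lambda>x. norm (f n x)) summable_on A" for n
    by (rule Infinite_Sum.abs_summable_on_comparison_test'[OF g]) (use bound in auto)
  have ha: "(\<lambda>x. norm (h x)) summable_on A"
    by (rule Infinite_Sum.abs_summable_on_comparison_test'[OF g]) (use h_bound in auto)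
  have ga: "Infinite_Set_Sum.abs_summable_on g A"
    by (rule abs_summable_equivalent[THEN iffD1])
       (use g summable_on_iff_abs_summable_on_real in blast)
  have "(\<lambda>n. infsetsum (f n) A) \<longlonglongrightarrow> infsetsum h A"
    unfolding infsetsum_def
    by (rule integral_dominated_convergence[where w = g])
       (use ga bound lim in \<open>auto simp: Infinite_Set_Sum.abs_summable_on_def AE_count_space\<close>)
  moreover have "infsetsum (f n) A = s n" for n
    using fa by (simp add: infsetsum_infsum abs_summable_equivalent infsumI[OF f])
  moreover have "infsetsum h A = infsum h A"
    using ha by (simp add: infsetsum_infsum abs_summable_equivalent)
  ultimately have "infsum h A = S"
    using s LIMSEQ_unique by simp
  then show ?thesis
    using ha abs_summable_summable by (metis has_sum_infsum)
qed

lemma has_sum_diff: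
  fixes f g :: "'a \<Rightarrow> 'b::topological_ab_group_add"
  assumes "(f has_sum a) A" "(g has_sum b) A"
  shows "((\<lambda>x. f x - g x) has_sum (a - b)) A"
  using has_sum_add[OF assms(1), of "\<lambda>x. - g x" "- b"] assms(2) by (simp add: has_sum_uminus)

lemma has_sum_product:
  fixes f :: "'a \<Rightarrow> complex" and g :: "'b \<Rightarrow> complex"
  assumes f: "(f has_sum a) A" "(\<lambda>x. norm (f x)) summable_on A"
    and g: "(g has_sum b) B" "(\<lambda>x. norm (g x)) summable_on B"
  shows "((\<lambda>(x, z). f x * g z) has_sum (a * b)) (A \<times> B)"
    and "(\<lambda>(x, z). norm (f x * g z)) summable_on (A \<times> B)"
proof -
  have "(\<lambda>(x, z). norm (f x) * norm (g z)) summable_on (A \<times> B)"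
  proof (rule summable_on_SigmaI)
    show "((\<lambda>z. case (x, z) of (x, z) \<Rightarrow> norm (f x) * norm (g z)) has_sum
        norm (f x) * (\<Sum>\<^sub>\<infinity>z\<in>B. norm (g z))) B" for x
      using has_sum_cmult_right[OF has_sum_infsum[OF g(2)]] by simp
    show "(\<lambda>x. norm (f x) * (\<Sum>\<^sub>\<infinity>z\<in>B. norm (g z))) summable_on A"
      by (intro summable_on_cmult_left f(2))
  qed auto
  then show *: "(\<lambda>(x, z). norm (f x * g z)) summable_on (A \<times> B)"
    by (simp add: norm_mult case_prod_unfold)
  show "((\<lambda>(x, z). f x * g z) has_sum (a * b)) (A \<times> B)"
  proof (rule has_sum_SigmaI)
    show "((\<lambda>z. case (x, z) of (x, z) \<Rightarrow> f x * g z) has_sum f x * b) B" for x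
      using has_sum_cmult_right[OF g(1)] by simp
    show "((\<lambda>x. f x * b) has_sum a * b) A"
      using has_sum_cmult_left[OF f(1)] .
    show "(\<lambda>(x, z). f x * g z) summable_on A \<times> B"
      by (rule abs_summable_summable) (use * in \<open>simp add: case_prod_unfold\<close>)
  qed
qed

lemma has_sum_int_shift:
  "((\<lambda>j. f (j + k)) has_sum S) UNIV \<longleftrightarrow> (f has_sum S) (UNIV :: int set)"
  by (rule has_sum_reindex_bij_witness[of _ "\<lambda>j. j - k" "\<lambda>j. j + k"]) auto

section \<open>The triple product\<close>

definition tri :: "int \<Rightarrow> int" where
  "tri j = j * (j - 1) div 2"

lemma tri_double: "2 * tri j = j * (j - 1)"
  unfolding tri_def by (rule dvd_mult_div_cancel) simp

text \<open>Polarization of a quadratic form. The cross term becomes the factor q^(jk) in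
  \<open>c_add\<close>, on which both the quasi-periodicity of the theta series and the
  factorization of the triple sum rest.\<close>

lemma tri_add: "tri (j + k) = tri j + tri k + j * k"
proof -
  have "2 * tri (j + k) = 2 * (tri j + tri k + j * k)"
    by (simp only: distrib_left tri_double) (simp add: algebra_simps)
  then show ?thesis by simp
qed

lemma tri_simps [simp]: "tri 0 = 0" "tri 1 = 0" "tri (-1) = 1"
  by (simp_all add: tri_def)

lemma summable_tri:
  fixes a b :: real
  assumes "0 < a" "a < 1" "0 < b"
  shows "summable (\<lambda>n. real n * (a powi tri (int n) * b ^ n))"
proof -
  \<comment> \<open>The ratio of consecutive terms is (n+1)/n * b * a^n, and (n+1)/n is at most 2
    once n is at least 1.\<close>
  have lim: "(\<lambda>n. 2 * b * a ^ n) \<longlonglongrightarrow> 2 * b * 0"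
    using assms by (intro tendsto_intros LIMSEQ_realpow_zero) auto
  then have "eventually (\<lambda>n. 2 * b * a ^ n < 1 / 2) sequentially"
    by (rule order_tendstoD) auto
  then obtain N where N: "\<And>n. n \<ge> N \<Longrightarrow> 2 * b * a ^ n < 1 / 2"
    by (auto simp: eventually_at_top_linorder)
  show ?thesis
  proof (rule summable_ratio_test)
    fix n assume n: "n \<ge> max N 1"
    have "a powi tri (int (Suc n)) = a powi tri (int n) * a ^ n"
      using assms tri_add[of "int n" 1] by (simp add: power_int_add add.commute)
    then have "norm (real (Suc n) * (a powi tri (int (Suc n)) * b ^ Suc n))
      = (real (Suc n) * b * a ^ n) * (a powi tri (int n) * b ^ n)"
      using assms by (simp add: abs_mult)
    also have "\<dots> \<le> (real n / 2) * (a powi tri (int n) * b ^ n)"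
    proof (rule mult_right_mono)
      have "real (Suc n) * (b * a ^ n) \<le> (real n * 2) * (b * a ^ n)"
        using n assms by (intro mult_right_mono) auto
      also have "\<dots> = real n * (2 * b * a ^ n)" by simp
      also have "\<dots> \<le> real n * (1 / 2)"
        using N[of n] n by (intro mult_left_mono) auto
      finally show "real (Suc n) * b * a ^ n \<le> real n / 2" by (simp add: mult.assoc)
    qed (use assms in auto)
    also have "\<dots> = 1 / 2 * norm (real n * (a powi tri (int n) * b ^ n))"
      using assms by (simp add: abs_mult)
    finally show "norm (real (Suc n) * (a powi tri (int (Suc n)) * b ^ Suc n))
      \<le> 1 / 2 * norm (real n * (a powi tri (int n) * b ^ n))" .
  qed auto
qed

section \<open>Finite triple products and their q-Pascal rules\<close>

locale nome =
  fixes q :: complex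
  assumes q_nz [simp]: "q \<noteq> 0" and norm_q: "norm q < 1"
begin

definition c :: "int \<Rightarrow> complex" where
  "c j = (-1) powi j * q powi tri j"

definition Q :: "nat \<Rightarrow> complex" where
  "Q n = (\<Prod>k<n. 1 - q ^ Suc k)"

text \<open>
  With value 0 at negative arguments, \<open>R k = 1 / (q; q)\<^sub>k\<close> satisfies \<open>R_step\<close> for all integers, so that the
  finite triple product is a sum over all integers and its induction steps are shifts of the index.
\<close>

definition R :: "int \<Rightarrow> complex" where
  "R k = (if k < 0 then 0 else 1 / Q (nat k))"

text \<open>The truncated theta product (y;q)_m (q/y;q)_n. Its two lengths are independent, so that
  an induction step adds a single factor.\<close>

definition triple :: "nat \<Rightarrow> nat \<Rightarrow> complex \<Rightarrow> complex" where
  "triple m n y = (\<Prod>k<m. 1 - y * q ^ k) * (\<Prod>k<n. 1 - q ^ Suc k / y)"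

lemma c_nz [simp]: "c j \<noteq> 0"
  by (simp add: c_def)

lemma c_add: "c (j + k) = c j * c k * q powi (j * k)"
  by (simp add: c_def tri_add power_int_add)

lemma c_simps [simp]: "c 0 = 1" "c 1 = -1" "c (-1) = -q"
  by (simp_all add: c_def)

lemma c_succ: "c (j + 1) = - c j * q powi j"
  by (simp add: c_add)

lemma c_pred: "c (j - 1) = - c j * q powi (1 - j)"
  using c_add[of j "-1"] by (simp add: power_int_add power_int_minus power_int_diff field_simps)

lemma norm_q_power_less: "norm (q ^ Suc n) < 1"
  using power_Suc_less_one[of "norm q" n] norm_q by (simp add: norm_power norm_mult)

lemma one_minus_q_power_nz: "n > 0 \<Longrightarrow> 1 - q ^ n \<noteq> 0"
  using norm_q_power_less[of "n - 1"] by auto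

lemma Q_nz [simp]: "Q n \<noteq> 0"
  unfolding Q_def using one_minus_q_power_nz by (simp del: power_Suc)

lemma Q_Suc: "Q (Suc n) = Q n * (1 - q ^ Suc n)"
  by (simp add: Q_def)

lemma Q_simps [simp]: "Q 0 = 1" "Q (Suc 0) = 1 - q"
  by (simp_all add: Q_def)

lemma R_step: "R k * (1 - q powi k) = R (k - 1)"
proof (cases "k > 0")
  case True
  then obtain n where k: "k = int (Suc n)"
    by (metis Suc_pred' int_nat_eq not_less zero_less_nat_eq less_le)
  have "1 - q ^ Suc n \<noteq> 0" by (rule one_minus_q_power_nz) simp
  then show ?thesis
    unfolding k R_def power_int_of_nat by (simp add: Q_Suc nat_add_distrib del: power_Suc)
next
  case False
  then show ?thesis by (cases "k = 0") (simp_all add: R_def)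
qed

text \<open>A q-Pascal rule: for natural m and n, \<open>c j * R (m - j) * R (n + j)\<close> is
  \<open>c j\<close> times the Gaussian binomial [m+n over m-j], divided by (q;q)_(m+n). The rule is
  the effect of a new factor 1 - y q^m on the coefficients.\<close>

lemma coeff_step_left:
  "c j * R (m - j) * R (n + j) - q powi m * (c (j - 1) * R (m - (j - 1)) * R (n + (j - 1)))
     = (1 - q powi (m + n + 1)) * (c j * R (m + 1 - j) * R (n + j))"
proof -
  have 1: "R (m - j) = R (m + 1 - j) * (1 - q powi (m + 1 - j))"
    using R_step[of "m + 1 - j"] by simp
  have 2: "R (n + (j - 1)) = R (n + j) * (1 - q powi (n + j))"
    using R_step[of "n + j"] by (simp add: algebra_simps)
  have 3: "q powi m * q powi (1 - j) = q powi (m + 1 - j)"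
    by (simp flip: power_int_add add: algebra_simps)
  have 4: "q powi (m + n + 1) = q powi (m + 1 - j) * q powi (n + j)"
    by (simp flip: power_int_add add: algebra_simps)
  have "q powi m * (c (j - 1) * R (m - (j - 1)) * R (n + (j - 1)))
      = - (q powi m * q powi (1 - j)) * c j * R (m + 1 - j) * R (n + (j - 1))"
    by (simp add: c_pred algebra_simps)
  then show ?thesis
    unfolding 1 2 3 4 by (simp add: algebra_simps)
qed

text \<open>The mirror image, for a new factor 1 - q^(n+1) / y.\<close>

lemma coeff_step_right:
  "c j * R (m - j) * R (n + j) - q powi (n + 1) * (c (j + 1) * R (m - (j + 1)) * R (n + (j + 1)))
     = (1 - q powi (m + n + 1)) * (c j * R (m - j) * R (n + 1 + j))"
proof -
  have 1: "R (n + j) = R (n + 1 + j) * (1 - q powi (n + 1 + j))"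
    using R_step[of "n + 1 + j"] by simp
  have 2: "R (m - (j + 1)) = R (m - j) * (1 - q powi (m - j))"
    using R_step[of "m - j"] by (simp add: algebra_simps)
  have 3: "q powi (n + 1) * q powi j = q powi (n + 1 + j)"
    by (simp flip: power_int_add)
  have 4: "q powi (m + n + 1) = q powi (n + 1 + j) * q powi (m - j)"
    by (simp flip: power_int_add add: algebra_simps)
  have "q powi (n + 1) * (c (j + 1) * R (m - (j + 1)) * R (n + (j + 1)))
      = - (q powi (n + 1) * q powi j) * c j * R (m - (j + 1)) * R (n + 1 + j)"
    unfolding c_succ by (simp add: algebra_simps)
  then show ?thesis
    unfolding 1 2 3 4 by (simp add: algebra_simps)
qed

text \<open>The weight \<open>w\<close> is left open so that one step serves two sums:
  \<open>w j\<close> = y^j with d = 0 gives the product, and \<open>w j\<close> = j with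
  \<open>v j\<close> = 1, y = 1 and d = 1 gives its derivative at 1.\<close>

lemma has_sum_step_left:
  assumes w: "\<And>j. w (j + 1) = y * w j + d * v j"
    and sw: "((\<lambda>j. w j * (c j * R (int m - j) * R (int n + j))) has_sum A) UNIV"
    and sv: "((\<lambda>j. v j * (c j * R (int m - j) * R (int n + j))) has_sum B) UNIV"
  shows "((\<lambda>j. w j * (c j * R (int (Suc m) - j) * R (int n + j)))
    has_sum ((1 - y * q ^ m) * A - q ^ m * d * B) / (1 - q ^ Suc (m + n))) UNIV"
proof -
  define r where "r j = c j * R (int m - j) * R (int n + j)" for j
  have "((\<lambda>j. (y * w j + d * v j) * r j) has_sum (y * A + d * B)) UNIV"
    using has_sum_add[OF has_sum_cmult_right[OF sw, of y] has_sum_cmult_right[OF sv, of d]]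
    by (simp add: r_def algebra_simps)
  then have "((\<lambda>j. w j * r (j - 1)) has_sum (y * A + d * B)) UNIV"
    by (subst has_sum_int_shift[of _ 1, symmetric]) (simp add: w)
  with sw have "((\<lambda>j. w j * r j - q ^ m * (w j * r (j - 1))) has_sum (A - q ^ m * (y * A + d * B))) UNIV"
    unfolding r_def by (intro has_sum_diff has_sum_cmult_right)
  moreover have "w j * r j - q ^ m * (w j * r (j - 1))
      = (1 - q ^ Suc (m + n)) * (w j * (c j * R (int (Suc m) - j) * R (int n + j)))" for j
  proof -
    have "r j - q ^ m * r (j - 1) = (1 - q powi (int m + int n + 1)) * (c j * R (int m + 1 - j) * R (int n + j))"
      using coeff_step_left[of j "int m" "int n"] by (simp add: r_def)
    also have "int m + int n + 1 = int (Suc (m + n))" by simp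
    finally have "w j * (r j - q ^ m * r (j - 1)) = w j * ((1 - q ^ Suc (m + n)) * (c j * R (int m + 1 - j) * R (int n + j)))"
      unfolding power_int_of_nat by simp
    then show ?thesis by (simp add: algebra_simps)
  qed
  ultimately have "((\<lambda>j. (1 - q ^ Suc (m + n)) * (w j * (c j * R (int (Suc m) - j) * R (int n + j))))
      has_sum (A - q ^ m * (y * A + d * B))) UNIV" by simp
  moreover have "1 - q ^ Suc (m + n) \<noteq> 0" by (rule one_minus_q_power_nz) simp
  ultimately have "((\<lambda>j. w j * (c j * R (int (Suc m) - j) * R (int n + j))) has_sum (A - q ^ m * (y * A + d * B)) / (1 - q ^ Suc (m + n))) UNIV"
    by (subst (asm) has_sum_cmult_right_iff) auto
  moreover have "A - q ^ m * (y * A + d * B) = (1 - y * q ^ m) * A - q ^ m * d * B"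
    by (simp add: algebra_simps)
  ultimately show ?thesis by simp
qed

lemma has_sum_step_right:
  assumes w: "\<And>j. w (j - 1) = y * w j + d * v j"
    and sw: "((\<lambda>j. w j * (c j * R (int m - j) * R (int n + j))) has_sum A) UNIV"
    and sv: "((\<lambda>j. v j * (c j * R (int m - j) * R (int n + j))) has_sum B) UNIV"
  shows "((\<lambda>j. w j * (c j * R (int m - j) * R (int (Suc n) + j)))
    has_sum ((1 - y * q ^ Suc n) * A - q ^ Suc n * d * B) / (1 - q ^ Suc (m + n))) UNIV"
proof -
  define r where "r j = c j * R (int m - j) * R (int n + j)" for j
  have "((\<lambda>j. (y * w j + d * v j) * r j) has_sum (y * A + d * B)) UNIV"
    using has_sum_add[OF has_sum_cmult_right[OF sw, of y] has_sum_cmult_right[OF sv, of d]]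
    by (simp add: r_def algebra_simps)
  then have "((\<lambda>j. w j * r (j + 1)) has_sum (y * A + d * B)) UNIV"
    by (subst has_sum_int_shift[of _ "-1", symmetric]) (simp add: w)
  with sw have "((\<lambda>j. w j * r j - q ^ Suc n * (w j * r (j + 1))) has_sum (A - q ^ Suc n * (y * A + d * B))) UNIV"
    unfolding r_def by (intro has_sum_diff has_sum_cmult_right)
  moreover have "w j * r j - q ^ Suc n * (w j * r (j + 1))
      = (1 - q ^ Suc (m + n)) * (w j * (c j * R (int m - j) * R (int (Suc n) + j)))" for j
  proof -
    have "r j - q powi int (Suc n) * r (j + 1) = (1 - q powi (int m + int n + 1)) * (c j * R (int m - j) * R (int (Suc n) + j))"
      using coeff_step_right[of j "int m" "int n"] by (simp add: r_def add.commute)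
    also have "int m + int n + 1 = int (Suc (m + n))" by simp
    finally have "w j * (r j - q ^ Suc n * r (j + 1)) = w j * ((1 - q ^ Suc (m + n)) * (c j * R (int m - j) * R (int (Suc n) + j)))"
      unfolding power_int_of_nat by simp
    then show ?thesis by (simp add: algebra_simps del: power_Suc)
  qed
  ultimately have "((\<lambda>j. (1 - q ^ Suc (m + n)) * (w j * (c j * R (int m - j) * R (int (Suc n) + j))))
      has_sum (A - q ^ Suc n * (y * A + d * B))) UNIV" by simp
  moreover have "1 - q ^ Suc (m + n) \<noteq> 0" by (rule one_minus_q_power_nz) simp
  ultimately have "((\<lambda>j. w j * (c j * R (int m - j) * R (int (Suc n) + j))) has_sum (A - q ^ Suc n * (y * A + d * B)) / (1 - q ^ Suc (m + n))) UNIV"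
    by (subst (asm) has_sum_cmult_right_iff) auto
  moreover have "A - q ^ Suc n * (y * A + d * B) = (1 - y * q ^ Suc n) * A - q ^ Suc n * d * B"
    by (simp add: algebra_simps)
  ultimately show ?thesis by simp
qed

lemma finite_triple_product:
  assumes y: "y \<noteq> 0"
  shows "((\<lambda>j. y powi j * (c j * R (int m - j) * R (int n + j)))
    has_sum triple m n y / Q (m + n)) UNIV"
proof (induction n)
  case 0
  show ?case
  proof (induction m)
    case 0
    show ?case
      by (rule has_sum_finite_neutralI[where B = "{0}"]) (auto simp: R_def triple_def)
  next
    case (Suc m)
    from has_sum_step_left[where w = "\<lambda>j. y powi j" and v = "\<lambda>j. y powi j" and d = 0 and y = y,
        OF _ Suc Suc] y
    show ?case
      by (simp add: power_int_add triple_def Q_Suc mult_ac del: power_Suc)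
  qed
next
  case (Suc n)
  from has_sum_step_right[where w = "\<lambda>j. y powi j" and v = "\<lambda>j. y powi j" and d = 0 and y = "1 / y",
      OF _ Suc Suc] y
  show ?case
    by (simp add: power_int_diff triple_def Q_Suc mult_ac del: power_Suc)
qed

text \<open>With at least one left factor, the product contains 1 - y; its derivative at 1 is
  therefore minus the product of the other factors there. This is why the left length is
  \<open>Suc m\<close>.\<close>

lemma finite_triple_product_derivative:
  "((\<lambda>j. of_int j * (c j * R (int (Suc m) - j) * R (int n + j)))
    has_sum - (Q m * Q n) / Q (Suc m + n)) UNIV"
proof (induction n)
  case 0
  show ?case
  proof (induction m)
    case 0
    show ?case
      by (rule has_sum_finite_neutralI[where B = "{0, 1}"]) (auto simp: R_def)
  next
    case (Suc m)
    \<comment> \<open>The undifferentiated product vanishes at 1, so the term with d drops out and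
      the step only multiplies by the new factor.\<close>
    have "((\<lambda>j. 1 * (c j * R (int (Suc m) - j) * R (int 0 + j))) has_sum 0) UNIV"
      using finite_triple_product[of 1 "Suc m" 0] by (simp add: triple_def lessThan_Suc_eq_insert_0)
    from has_sum_step_left[where w = "\<lambda>j. of_int j" and v = "\<lambda>j. 1" and d = 1 and y = 1,
        OF _ Suc this] one_minus_q_power_nz[of "Suc m"]
    show ?case
      by (simp add: Q_Suc[of m] Q_Suc[of "Suc m"] mult_ac del: power_Suc)
  qed
next
  case (Suc n)
  have "((\<lambda>j. 1 * (c j * R (int (Suc m) - j) * R (int n + j))) has_sum 0) UNIV"
    using finite_triple_product[of 1 "Suc m" n] by (simp add: triple_def lessThan_Suc_eq_insert_0)
  from has_sum_step_right[where w = "\<lambda>j. of_int j" and v = "\<lambda>j. 1" and d = "-1" and y = 1,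
      OF _ Suc this]
  show ?case
    by (simp add: Q_Suc[of n] Q_Suc[of "Suc (m + n)"] mult_ac del: power_Suc)
qed

section \<open>Passage to infinite products\<close>

definition Qinf :: complex where
  "Qinf = (\<Prod>n. 1 - q ^ Suc n)"

definition P :: "complex \<Rightarrow> complex" where
  "P y = (\<Prod>n. (1 - q ^ Suc n) * (1 - q ^ n * y) * (1 - q ^ Suc n * inverse y))"

lemma convergent_prod_geometric: "convergent_prod (\<lambda>n. 1 - a * q ^ n)"
  by (rule abs_convergent_prod_imp_convergent_prod[OF summable_imp_abs_convergent_prod])
     (use norm_q in \<open>auto simp: norm_mult norm_power intro!: summable_mult summable_geometric\<close>)

lemma convergent_prod_q: "convergent_prod (\<lambda>n. 1 - q ^ Suc n)"
  using convergent_prod_geometric[of q] by simp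

lemma Qinf_nz [simp]: "Qinf \<noteq> 0"
  unfolding Qinf_def using convergent_prod_q one_minus_q_power_nz
  by (intro prodinf_nonzero) (auto simp del: power_Suc)

lemma LIMSEQ_Q: "Q \<longlonglongrightarrow> Qinf"
proof -
  have "(\<lambda>n. Q (Suc n)) \<longlonglongrightarrow> Qinf"
    using convergent_prod_LIMSEQ[OF convergent_prod_q]
    by (simp add: Q_def Qinf_def lessThan_Suc_atMost del: power_Suc)
  then show ?thesis by (rule LIMSEQ_imp_Suc)
qed

lemma LIMSEQ_triple: "(\<lambda>n. triple n n y) \<longlonglongrightarrow> P y / Qinf"
proof -
  have "convergent_prod (\<lambda>n. (1 - q ^ Suc n) * (1 - y * q ^ n) * (1 - (q * inverse y) * q ^ n))"
    by (intro convergent_prod_mult convergent_prod_geometric convergent_prod_q)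
  then have "convergent_prod (\<lambda>n. (1 - q ^ Suc n) * (1 - q ^ n * y) * (1 - q ^ Suc n * inverse y))"
    by (simp add: mult_ac)
  from convergent_prod_LIMSEQ[OF this]
  have "(\<lambda>n. Q (Suc n) * triple (Suc n) (Suc n) y) \<longlonglongrightarrow> P y"
    by (simp add: P_def Q_def triple_def lessThan_Suc_atMost prod.distrib mult_ac divide_inverse del: power_Suc)
  then have "(\<lambda>n. Q n * triple n n y) \<longlonglongrightarrow> P y"
    by (rule LIMSEQ_imp_Suc)
  from tendsto_divide[OF this LIMSEQ_Q Qinf_nz] show ?thesis by simp
qed

lemma LIMSEQ_R: "(\<lambda>n. R (int n + k)) \<longlonglongrightarrow> 1 / Qinf"
proof -
  have "filterlim (\<lambda>n. nat (int n + k)) at_top sequentially"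
    unfolding filterlim_at_top
  proof
    fix Z
    show "eventually (\<lambda>n. Z \<le> nat (int n + k)) sequentially"
      using eventually_ge_at_top[of "Z + nat \<bar>k\<bar>"] by eventually_elim linarith
  qed
  from filterlim_compose[OF LIMSEQ_Q this]
  have "(\<lambda>n. 1 / Q (nat (int n + k))) \<longlonglongrightarrow> 1 / Qinf"
    by (intro tendsto_intros) auto
  moreover have "eventually (\<lambda>n. 1 / Q (nat (int n + k)) = R (int n + k)) sequentially"
    using eventually_ge_at_top[of "nat \<bar>k\<bar>"] by eventually_elim (auto simp: R_def)
  ultimately show ?thesis by (rule Lim_transform_eventually)
qed

text \<open>Provides the majorant, uniform in the truncation, for the two limits below.\<close>

lemma R_bounded: "\<exists>B>0. \<forall>k. norm (R k) \<le> B"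
proof -
  have "Bseq (\<lambda>n. R (int n))"
    using LIMSEQ_R[of 0] by (intro convergent_imp_Bseq) (auto simp: convergent_def)
  then obtain B where B: "B > 0" "\<And>n. norm (R (int n)) \<le> B"
    by (auto simp: Bseq_def)
  have "norm (R k) \<le> B" for k
    using B(1) B(2)[of "nat k"] by (cases "k < 0") (auto simp: R_def)
  with B(1) show ?thesis by blast
qed

lemma norm_c: "norm (c j) = norm q powi tri j"
  by (simp add: c_def norm_mult norm_power_int)

lemma summable_index_c:
  assumes "y \<noteq> 0"
  shows "(\<lambda>j. norm (of_int j * (c j * y powi j))) summable_on UNIV"
proof (rule norm_summable_on_int)
  have nq: "0 < norm q" by simp
  show "summable (\<lambda>n. norm (of_int (int n) * (c (int n) * y powi int n)))"
    using summable_tri[OF nq norm_q, of "norm y"] assms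
    by (simp add: norm_mult norm_c norm_power)
  \<comment> \<open>Reflection costs one factor |q|^n, so the negative half is a series of the same
    kind with |q| / |y| in place of |y|.\<close>
  have "tri (- int n) = tri (int n) + int n" for n
    by (simp add: tri_def algebra_simps)
  then have "norm q powi tri (- int n) * norm (y powi (- int n))
      = norm q powi tri (int n) * (norm q / norm y) ^ n" for n
    using assms by (simp add: power_int_add power_int_minus norm_power norm_inverse norm_divide power_divide field_simps)
  then show "summable (\<lambda>n. norm (of_int (- int n) * (c (- int n) * y powi (- int n))))"
    using summable_tri[OF nq norm_q, of "norm q / norm y"] assms
    by (simp add: norm_mult norm_c)
qed

lemma summable_c:
  assumes "y \<noteq> 0"
  shows "(\<lambda>j. norm (c j * y powi j)) summable_on UNIV"
proof -
  \<comment> \<open>The factor j kills the term at 0, whose norm is 1; the correction restores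
    it.\<close>
  have "(\<lambda>j. norm (of_int j * (c j * y powi j)) + (if j = 0 then 1 else 0)) summable_on UNIV"
    by (intro summable_on_add summable_index_c assms finite_nonzero_values_imp_summable_on) auto
  then show ?thesis
  proof (rule Infinite_Sum.abs_summable_on_comparison_test')
    fix j :: int
    have "1 * norm (c j * y powi j) \<le> norm (of_int j :: complex) * norm (c j * y powi j)" if "j \<noteq> 0"
      using that by (intro mult_right_mono) auto
    then show "norm (c j * y powi j) \<le> norm (of_int j * (c j * y powi j)) + (if j = 0 then 1 else 0)"
      by (auto simp: norm_mult)
  qed
qed

theorem triple_product:
  assumes "y \<noteq> 0"
  shows "((\<lambda>j. c j * y powi j) has_sum P y) UNIV"
proof -
  obtain B where B: "B > 0" "\<And>k. norm (R k) \<le> B" using R_bounded by blast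
  have "((\<lambda>j. y powi j * (c j * (1 / Qinf) * (1 / Qinf))) has_sum P y / Qinf / Qinf) UNIV"
  proof (rule has_sum_dominated_convergence)
    show "((\<lambda>j. y powi j * (c j * R (int n + - j) * R (int n + j))) has_sum triple n n y / Q (n + n)) UNIV" for n
      using finite_triple_product[OF assms, of n n] by simp
    show "(\<lambda>j. norm (c j * y powi j) * (B * B)) summable_on UNIV"
      by (intro summable_on_cmult_left summable_c assms)
    show "norm (y powi j * (c j * R (int n + - j) * R (int n + j))) \<le> norm (c j * y powi j) * (B * B)" for n j
    proof -
      have "norm (R (int n + - j)) * norm (R (int n + j)) \<le> B * B"
        using B by (intro mult_mono) (auto intro: less_imp_le)
      then have "norm (c j * y powi j) * (norm (R (int n + - j)) * norm (R (int n + j))) \<le> norm (c j * y powi j) * (B * B)"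
        by (intro mult_left_mono) auto
      then show ?thesis by (simp add: norm_mult mult_ac)
    qed
    show "(\<lambda>n. y powi j * (c j * R (int n + - j) * R (int n + j))) \<longlonglongrightarrow> y powi j * (c j * (1 / Qinf) * (1 / Qinf))" for j
      by (intro tendsto_intros LIMSEQ_R)
    have "filterlim (\<lambda>n::nat. n + n) at_top sequentially"
      by (rule filterlim_at_top_mono[OF filterlim_ident]) auto
    from filterlim_compose[OF LIMSEQ_Q this]
    show "(\<lambda>n. triple n n y / Q (n + n)) \<longlonglongrightarrow> P y / Qinf / Qinf"
      by (intro tendsto_intros LIMSEQ_triple) auto
  qed
  from has_sum_cmult_right[OF this, of "Qinf * Qinf"] show ?thesis
    by (simp add: mult_ac)
qed

text \<open>Jacobi's identity for (q;q)^3, as the limit of the finite derivative with lengths n + 1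
  and n.\<close>

theorem triple_product_derivative:
  "((\<lambda>j. of_int j * c j) has_sum - (Qinf ^ 3)) UNIV"
proof -
  obtain B where B: "B > 0" "\<And>k. norm (R k) \<le> B" using R_bounded by blast
  have "((\<lambda>j. of_int j * (c j * (1 / Qinf) * (1 / Qinf))) has_sum - (Qinf * Qinf) / Qinf) UNIV"
  proof (rule has_sum_dominated_convergence)
    show "((\<lambda>j. of_int j * (c j * R (int n + (1 - j)) * R (int n + j))) has_sum - (Q n * Q n) / Q (Suc n + n)) UNIV" for n
      using finite_triple_product_derivative[of n n] by (simp add: algebra_simps)
    show "(\<lambda>j. norm (of_int j * (c j * 1 powi j)) * (B * B)) summable_on UNIV"
      by (intro summable_on_cmult_left summable_index_c) simp
    show "norm (of_int j * (c j * R (int n + (1 - j)) * R (int n + j))) \<le> norm (of_int j * (c j * 1 powi j)) * (B * B)" for n j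
    proof -
      have "norm (R (int n + (1 - j))) * norm (R (int n + j)) \<le> B * B"
        using B by (intro mult_mono) (auto intro: less_imp_le)
      then have "norm (of_int j * c j) * (norm (R (int n + (1 - j))) * norm (R (int n + j))) \<le> norm (of_int j * c j) * (B * B)"
        by (intro mult_left_mono) auto
      then show ?thesis by (simp add: norm_mult mult_ac)
    qed
    show "(\<lambda>n. of_int j * (c j * R (int n + (1 - j)) * R (int n + j))) \<longlonglongrightarrow> of_int j * (c j * (1 / Qinf) * (1 / Qinf))" for j
      by (intro tendsto_intros LIMSEQ_R)
    have "filterlim (\<lambda>n::nat. Suc n + n) at_top sequentially"
      by (rule filterlim_at_top_mono[OF filterlim_ident]) auto
    from filterlim_compose[OF LIMSEQ_Q this]
    show "(\<lambda>n. - (Q n * Q n) / Q (Suc n + n)) \<longlonglongrightarrow> - (Qinf * Qinf) / Qinf"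
      by (intro tendsto_intros LIMSEQ_Q) auto
  qed
  from has_sum_cmult_right[OF this, of "Qinf * Qinf"] show ?thesis
    by (simp add: mult_ac power3_eq_cube)
qed

text \<open>This is the triple product at y = 1, where the factor 1 - y vanishes.\<close>

lemma sum_c: "(c has_sum 0) UNIV"
proof -
  have "(\<lambda>n. triple n n 1) \<longlonglongrightarrow> 0"
    by (rule tendsto_eventually, rule eventually_sequentiallyI[of 1])
       (auto simp: triple_def intro!: bexI[where x = 0])
  with LIMSEQ_triple[of 1] have "P 1 = 0"
    using LIMSEQ_unique by force
  with triple_product[of 1] show ?thesis by simp
qed

end

section \<open>The Appell--Lerch sum\<close>

text \<open>
  \<open>weight j\<close> lists the coefficients of the Laurent polynomial
  \<open>(x\<^sup>j\<^sup>+\<^sup>1 - x + j x (1 - x)) / (1 - x)\<^sup>2\<close>.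
\<close>

definition weight :: "int \<Rightarrow> int \<Rightarrow> int" where
  "weight j n = (if 1 \<le> n \<and> n < j then j - n else if j < n \<and> n \<le> 0 then n - j else 0)"

lemma weight_shift: "weight (j + 1) (n + 1) = weight j n + (if n = 0 then j else 0)"
  by (auto simp: weight_def)

definition weight_sum :: "int \<Rightarrow> complex \<Rightarrow> complex" where
  "weight_sum j x = (x powi (j + 1) - x + of_int j * x * (1 - x)) / (1 - x) ^ 2"

lemma weight_sum_succ:
  assumes "x \<noteq> 0" "x \<noteq> 1"
  shows "weight_sum (j + 1) x = x * weight_sum j x + of_int j * x"
proof -
  have "x powi (j + 1 + 1) = x * x powi (j + 1)"
    using assms by (subst power_int_add) auto
  then have "x powi (j + 1 + 1) - x + of_int (j + 1) * x * (1 - x)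
      = x * (x powi (j + 1) - x + of_int j * x * (1 - x)) + of_int j * x * (1 - x) ^ 2"
    by (simp add: algebra_simps power2_eq_square)
  moreover have "(x * a + b * (1 - x) ^ 2) / (1 - x) ^ 2 = x * (a / (1 - x) ^ 2) + b" for a b
    using assms by (simp add: add_divide_distrib)
  ultimately show ?thesis
    unfolding weight_sum_def by (simp only:)
qed

text \<open>Since x is nonzero, the recurrence in j can be reversed: \<open>step\<close> is an
  equivalence, and the induction runs both ways from j = 0, where all weights vanish.\<close>

lemma has_sum_weight:
  assumes x: "x \<noteq> 0" "x \<noteq> 1"
  shows "((\<lambda>n. of_int (weight j n) * x powi n) has_sum weight_sum j x) UNIV"
proof -
  have step: "((\<lambda>n. of_int (weight (j + 1) n) * x powi n) has_sum weight_sum (j + 1) x) UNIV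
      \<longleftrightarrow> ((\<lambda>n. of_int (weight j n) * x powi n) has_sum weight_sum j x) UNIV" (is "?L \<longleftrightarrow> ?R") for j
  proof -
    define d where "d n = (if n = 0 then of_int j * x else 0)" for n :: int
    have d: "(d has_sum of_int j * x) UNIV"
      by (rule has_sum_finite_neutralI[where B = "{0}"]) (auto simp: d_def)
    have "?L \<longleftrightarrow> ((\<lambda>n. of_int (weight (j + 1) (n + 1)) * x powi (n + 1)) has_sum weight_sum (j + 1) x) UNIV"
      by (rule has_sum_int_shift[symmetric])
    also have "(\<lambda>n. of_int (weight (j + 1) (n + 1)) * x powi (n + 1))
        = (\<lambda>n. x * (of_int (weight j n) * x powi n) + d n)"
      unfolding weight_shift using x by (auto simp: d_def power_int_add distrib_left mult_ac)
    also have "((\<lambda>n. x * (of_int (weight j n) * x powi n) + d n) has_sum weight_sum (j + 1) x) UNIV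
        \<longleftrightarrow> ((\<lambda>n. x * (of_int (weight j n) * x powi n)) has_sum weight_sum (j + 1) x - of_int j * x) UNIV"
      using has_sum_diff[OF _ d, of "\<lambda>n. x * (of_int (weight j n) * x powi n) + d n"]
        has_sum_add[OF _ d, of "\<lambda>n. x * (of_int (weight j n) * x powi n)" "weight_sum (j + 1) x - of_int j * x"]
      by auto
    also have "\<dots> \<longleftrightarrow> ?R"
      using x by (simp add: has_sum_cmult_right_iff weight_sum_succ)
    finally show ?thesis .
  qed
  show ?thesis
  proof (induction j rule: int_induct[where k = 0])
    case base
    have "weight 0 n = 0" for n by (auto simp: weight_def)
    then show ?case by (simp add: weight_sum_def)
  next
    case (step1 i)
    then show ?case by (simp only: step)
  next
    case (step2 i)
    then show ?case using step[of "i - 1"] by simp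
  qed
qed

text \<open>The substitution r = s + 2m - 1 solves the parity condition on r - s and splits r s / 2
  into s(s-1)/2 + m s, so that \<open>F22\<close> becomes a series in \<open>c s\<close> and
  q^(ms).\<close>

lemma F22_exponent:
  fixes m s :: nat
  assumes "m \<ge> 1" "s \<ge> 1"
  shows "int ((s + 2 * m - 1) * s div 2) = tri (int s) + int m * int s"
proof -
  obtain k where k: "m = Suc k" using assms(1) by (cases m) auto
  have "int ((s + 2 * m - 1) * s) = int s * (int s - 1) + 2 * (int m * int s)"
    by (simp add: k algebra_simps)
  also have "\<dots> = 2 * (tri (int s) + int m * int s)"
    by (simp only: distrib_left tri_double)
  finally show ?thesis by (simp add: zdiv_int)
qed

locale nome_point = nome +
  fixes y :: complex
  assumes y_nz [simp]: "y \<noteq> 0" and y_q: "y * q powi k \<noteq> 1"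
begin

definition x :: "int \<Rightarrow> complex" where
  "x i = y * q powi i"

lemma x_nz [simp]: "x i \<noteq> 0" and x_neq_1 [simp]: "x i \<noteq> 1" "1 \<noteq> x i"
  using y_q[of i] by (auto simp: x_def)

text \<open>Quasi-periodicity of the theta function, obtained by shifting the index of its
  series.\<close>

lemma P_shift: "c i * y powi i * P (x i) = P y"
proof -
  have "((\<lambda>j. c (j + i) * y powi (j + i)) has_sum P y) UNIV"
    using has_sum_int_shift[of "\<lambda>j. c j * y powi j" i] triple_product[OF y_nz] by simp
  moreover have "c (j + i) * y powi (j + i) = c i * y powi i * (c j * x i powi j)" for j
    by (simp add: c_add x_def power_int_add power_int_mult_distrib power_int_mult mult_ac)
  ultimately have "((\<lambda>j. c i * y powi i * (c j * x i powi j)) has_sum P y) UNIV"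
    by simp
  moreover have "((\<lambda>j. c i * y powi i * (c j * x i powi j)) has_sum c i * y powi i * P (x i)) UNIV"
    by (intro has_sum_cmult_right triple_product x_nz)
  ultimately show ?thesis by (rule has_sum_unique[symmetric])
qed

section \<open>The double series behind F22\<close>

definition D :: complex where
  "D = (\<Sum>\<^sub>\<infinity>(m, s)\<in>{1..} \<times> {1..}. of_nat s * c (int s) * q ^ (m * s))"

lemma summable_D:
  "(\<lambda>(m, s). norm (of_nat s * c (int s) * q ^ (m * s))) summable_on ({1..} \<times> {1..})"
proof -
  define f where "f m = q ^ m" for m :: nat
  define g where "g s = of_nat s * c (int s)" for s :: nat
  have "summable (\<lambda>m. norm (f m))"
    using norm_q by (simp add: f_def norm_power summable_geometric)
  then have f: "(\<lambda>m. norm (f m)) summable_on UNIV" "f summable_on UNIV"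
    using norm_summable_imp_summable_on[of "\<lambda>m. norm (f m)"] norm_summable_imp_summable_on[of f] by auto
  have "summable (\<lambda>s. norm (g s))"
    using summable_tri[of "norm q" 1] norm_q by (simp add: g_def norm_mult norm_c)
  then have g: "(\<lambda>s. norm (g s)) summable_on UNIV" "g summable_on UNIV"
    using norm_summable_imp_summable_on[of "\<lambda>m. norm (g m)"] norm_summable_imp_summable_on[of g] by auto
  from has_sum_product(2)[OF has_sum_infsum[OF f(2)] f(1) has_sum_infsum[OF g(2)] g(1)]
  have "(\<lambda>(m, s). norm (f m * g s)) summable_on ({1..} \<times> {1..})"
    by (rule summable_on_subset) auto
  then show ?thesis
  proof (rule summable_on_comparison_test)
    fix p :: "nat \<times> nat" assume "p \<in> {1..} \<times> {1..}"
    then obtain m s where p: "p = (m, s)" "m \<ge> 1" "s \<ge> 1" by auto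
    \<comment> \<open>As s is at least 1, q^(ms) is dominated by q^m, and the double series by a
      product of two single ones.\<close>
    then have "m * 1 \<le> m * s" by (intro mult_left_mono) auto
    then have "norm q ^ (m * s) \<le> norm q ^ m"
      using norm_q by (intro power_decreasing) auto
    then have "norm (g s) * norm (q ^ (m * s)) \<le> norm (g s) * norm (f m)"
      by (intro mult_left_mono) (auto simp: f_def norm_power)
    then show "(case p of (m, s) \<Rightarrow> norm (of_nat s * c (int s) * q ^ (m * s))) \<le> (case p of (m, s) \<Rightarrow> norm (f m * g s))"
      by (simp add: p g_def norm_mult mult_ac)
  qed auto
qed

lemma has_sum_D:
  "((\<lambda>(m, s). of_nat s * c (int s) * q ^ (m * s)) has_sum D) ({1..} \<times> {1..})"
  unfolding D_def
  by (rule has_sum_infsum, rule abs_summable_summable) (use summable_D in \<open>simp add: case_prod_unfold\<close>)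

text \<open>The minus sign comes from the opposite parity of r and s: (-1)^r = -(-1)^s, and (-1)^s
  is the sign inside \<open>c s\<close>.\<close>

lemma has_sum_F22:
  "((\<lambda>(r, s). (-1) ^ r * of_nat s * q ^ (r * s div 2)) has_sum - D)
     {(r, s). r > s \<and> s > 0 \<and> odd (r - s)}"
proof -
  have "((\<lambda>(m, s). - (of_nat s * c (int s) * q ^ (m * s))) has_sum - D) ({1..} \<times> {1..})"
    using has_sum_D by (simp add: has_sum_uminus case_prod_unfold)
  also have "?this \<longleftrightarrow> ?thesis"
  proof (rule has_sum_reindex_bij_witness[where j = "\<lambda>(m, s). (s + 2 * m - 1, s)"
        and i = "\<lambda>(r, s). ((r - s + 1) div 2, s)"])
    fix b :: "nat \<times> nat" assume b: "b \<in> {(r, s). r > s \<and> s > 0 \<and> odd (r - s)}"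
    then obtain r s where rs: "b = (r, s)" "r > s" "s > 0" "odd (r - s)" by auto
    from rs(4) obtain k where k: "r - s = 2 * k + 1" by (rule oddE)
    with rs have r: "r = s + 2 * k + 1" by simp
    show "(case (case b of (r, s) \<Rightarrow> ((r - s + 1) div 2, s)) of (m, s) \<Rightarrow> (s + 2 * m - 1, s)) = b"
      by (simp add: rs r)
    show "(case b of (r, s) \<Rightarrow> ((r - s + 1) div 2, s)) \<in> {1..} \<times> {1..}"
      using rs by (simp add: r)
  next
    fix a :: "nat \<times> nat" assume a: "a \<in> {1..} \<times> {1..}"
    then obtain m s where ms: "a = (m, s)" "m \<ge> 1" "s \<ge> 1" by auto
    then obtain k where k: "m = Suc k" by (cases m) auto
    show "(case (case a of (m, s) \<Rightarrow> (s + 2 * m - 1, s)) of (r, s) \<Rightarrow> ((r - s + 1) div 2, s)) = a"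
      by (simp add: ms(1) k)
    show "(case a of (m, s) \<Rightarrow> (s + 2 * m - 1, s)) \<in> {(r, s). r > s \<and> s > 0 \<and> odd (r - s)}"
      using ms by (simp add: k)
    have "q ^ ((s + 2 * m - 1) * s div 2) = q powi (tri (int s) + int m * int s)"
      unfolding F22_exponent[OF ms(2,3), symmetric] by simp
    also have "\<dots> = q powi tri (int s) * q ^ (m * s)"
      by (simp add: power_int_add flip: of_nat_mult)
    finally have "q ^ ((s + 2 * m - 1) * s div 2) = q powi tri (int s) * q ^ (m * s)" .
    moreover have "(-1) ^ (s + 2 * m - 1) = - ((-1) ^ s :: complex)"
      by (simp add: k power_add power_mult)
    ultimately show "(case (case a of (m, s) \<Rightarrow> (s + 2 * m - 1, s)) of (r, s) \<Rightarrow> (-1) ^ r * of_nat s * q ^ (r * s div 2))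
      = (case a of (m, s) \<Rightarrow> - (of_nat s * c (int s) * q ^ (m * s)))"
      by (simp add: ms(1) c_def)
  qed simp
  finally show ?thesis .
qed

text \<open>What remains of a term of the triple sum once \<open>c (i + n) * y powi (i + n)\<close>
  is extracted. The weight confines it to two opposite cones, 1 <= n < j and j < n <= 0.\<close>

definition Phi :: "int \<times> int \<Rightarrow> complex" where
  "Phi = (\<lambda>(n, j). of_int (weight j n) * c j / c n)"

lemma Phi_pos:
  assumes "m \<ge> 1" "s \<ge> 1"
  shows "Phi (int m, int m + int s) = of_nat s * c (int s) * q ^ (m * s)"
proof -
  have "c (int m + int s) / c (int m) = c (int s) * q powi int (m * s)"
    unfolding c_add of_nat_mult by simp
  also have "\<dots> = c (int s) * q ^ (m * s)"
    by (simp only: power_int_of_nat)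
  finally have "c (int m + int s) / c (int m) = c (int s) * q ^ (m * s)" .
  moreover have "weight (int m + int s) (int m) = int s"
    using assms by (simp add: weight_def)
  ultimately show ?thesis by (simp add: Phi_def flip: times_divide_eq_right)
qed

text \<open>The offset in n = 1 - m matters: it cancels the surplus q^s in
  \<open>c (- int s)\<close>, so the negative cone repeats the positive one term by term.\<close>

lemma Phi_neg:
  assumes "m \<ge> 1" "s \<ge> 1"
  shows "Phi (1 - int m, 1 - int m - int s) = of_nat s * c (int s) * q ^ (m * s)"
proof -
  have "c (1 - int m + - int s) / c (1 - int m) = c (- int s) * q powi ((1 - int m) * (- int s))"
    by (simp only: c_add) simp
  moreover have "tri (- int s) = tri (int s) + int s" by (simp add: tri_def algebra_simps)
  then have "c (- int s) = c (int s) * q powi int s"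
    unfolding c_def power_int_minus_one_minus by (simp add: power_int_add del: power_int_of_nat)
  moreover have "q powi int s * q powi ((1 - int m) * (- int s)) = q powi int (m * s)"
    by (simp flip: power_int_add add: algebra_simps del: power_int_of_nat)
  ultimately have "c (1 - int m + - int s) / c (1 - int m) = c (int s) * q powi int (m * s)"
    by (simp only: mult.assoc)
  then have "c (1 - int m - int s) / c (1 - int m) = c (int s) * q ^ (m * s)"
    by (simp only: power_int_of_nat) simp
  moreover have "weight (1 - int m - int s) (1 - int m) = int s"
    using assms by (simp add: weight_def)
  ultimately show ?thesis by (simp add: Phi_def flip: times_divide_eq_right)
qed

text \<open>With h the identity this gives the value, with h the norm absolute convergence. Each
  cone is a copy of the quadrant, hence S + S.\<close>

lemma has_sum_Phi_general:
  fixes h :: "complex \<Rightarrow> 'b::{real_normed_vector}"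
  assumes h0: "h 0 = 0"
    and s: "((\<lambda>(m, s). h (of_nat s * c (int s) * q ^ (m * s))) has_sum S) ({1..} \<times> {1..})"
  shows "((\<lambda>p. h (Phi p)) has_sum (S + S)) UNIV"
proof -
  define N1 N2 :: "(int \<times> int) set" where
    "N1 = {(n, j). 1 \<le> n \<and> n < j}" and "N2 = {(n, j). j < n \<and> n \<le> 0}"
  note s
  also have "((\<lambda>(m, s). h (of_nat s * c (int s) * q ^ (m * s))) has_sum S) ({1..} \<times> {1..})
      \<longleftrightarrow> ((\<lambda>p. h (Phi p)) has_sum S) N1"
    by (rule has_sum_reindex_bij_witness[where j = "\<lambda>(m, s). (int m, int m + int s)" and i = "\<lambda>(n, j). (nat n, nat (j - n))"])
      (auto simp: N1_def Phi_pos)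
  finally have N1: "((\<lambda>p. h (Phi p)) has_sum S) N1" .
  note s
  also have "((\<lambda>(m, s). h (of_nat s * c (int s) * q ^ (m * s))) has_sum S) ({1..} \<times> {1..})
      \<longleftrightarrow> ((\<lambda>p. h (Phi p)) has_sum S) N2"
    by (rule has_sum_reindex_bij_witness[where j = "\<lambda>(m, s). (1 - int m, 1 - int m - int s)" and i = "\<lambda>(n, j). (nat (1 - n), nat (n - j))"])
      (auto simp: N2_def Phi_neg)
  finally have N2: "((\<lambda>p. h (Phi p)) has_sum S) N2" .
  have "N1 \<inter> N2 = {}" by (auto simp: N1_def N2_def)
  with N1 N2 have "((\<lambda>p. h (Phi p)) has_sum (S + S)) (N1 \<union> N2)"
    by (rule has_sum_Un_disjoint)
  moreover have "Phi p = 0" if "p \<notin> N1 \<union> N2" for p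
  proof (cases p)
    case (Pair n j)
    with that have "\<not> (1 \<le> n \<and> n < j)" "\<not> (j < n \<and> n \<le> 0)"
      by (auto simp: N1_def N2_def)
    then have "weight j n = 0" unfolding weight_def by (simp only: if_False)
    then show ?thesis by (simp add: Phi_def Pair)
  qed
  then have "((\<lambda>p. h (Phi p)) has_sum (S + S)) (N1 \<union> N2) \<longleftrightarrow> ?thesis"
    by (intro has_sum_cong_neutral) (auto simp: h0)
  ultimately
  show ?thesis by blast
qed

lemma has_sum_Phi: "(Phi has_sum 2 * D) UNIV"
  using has_sum_Phi_general[of "\<lambda>z. z", OF refl has_sum_D] unfolding mult_2 .

lemma summable_Phi: "(\<lambda>p. norm (Phi p)) summable_on UNIV"
proof -
  have "((\<lambda>(m, s). norm (of_nat s * c (int s) * q ^ (m * s))) has_sum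
     infsum (\<lambda>(m, s). norm (of_nat s * c (int s) * q ^ (m * s))) ({1..} \<times> {1..})) ({1..} \<times> {1..})"
    using summable_D by (rule has_sum_infsum)
  from has_sum_Phi_general[of norm, OF _ this] show ?thesis
    by (auto simp: summable_on_def)
qed

definition V :: "complex \<Rightarrow> complex" where
  "V z = z * P z / (1 - z) ^ 2 - Qinf ^ 3 * z / (1 - z)"

text \<open>The two corrections in the numerator z^(j+1) - z + j z (1 - z) give it a double zero at
  1. Summed against \<open>c j\<close>, the first contributes 0 by \<open>sum_c\<close> and the
  second the \<open>Qinf ^ 3\<close> term.\<close>

lemma has_sum_V:
  assumes z: "z \<noteq> 0" "z \<noteq> 1"
  shows "((\<lambda>j. c j * weight_sum j z) has_sum V z) UNIV"
proof -
  define e where "e = 1 / (1 - z) ^ 2"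
  have e1: "z / (1 - z) = e * z * (1 - z)"
    unfolding e_def power2_eq_square using z by simp
  have e2: "weight_sum j z = e * (z * z powi j - z + of_int j * z * (1 - z))" for j
    unfolding e_def weight_sum_def power_int_add[OF disjI1[OF z(1)]] by simp
  have "((\<lambda>j. e * z * (c j * z powi j)) has_sum (e * z * P z)) UNIV"
    by (rule has_sum_cmult_right[OF triple_product[OF z(1)]])
  moreover have "((\<lambda>j. e * z * c j) has_sum (e * z * 0)) UNIV"
    by (rule has_sum_cmult_right[OF sum_c])
  ultimately have "((\<lambda>j. e * z * (c j * z powi j) - e * z * c j) has_sum (e * z * P z - e * z * 0)) UNIV"
    by (rule has_sum_diff)
  moreover have "((\<lambda>j. e * z * (1 - z) * (of_int j * c j)) has_sum (e * z * (1 - z) * - (Qinf ^ 3))) UNIV"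
    by (rule has_sum_cmult_right[OF triple_product_derivative])
  ultimately have "((\<lambda>j. e * z * (c j * z powi j) - e * z * c j + e * z * (1 - z) * (of_int j * c j))
      has_sum (e * z * P z - e * z * 0 + e * z * (1 - z) * - (Qinf ^ 3))) UNIV"
    by (rule has_sum_add)
  moreover have "e * z * (c j * z powi j) - e * z * c j + e * z * (1 - z) * (of_int j * c j)
      = c j * weight_sum j z" for j
    by (simp add: e2 algebra_simps)
  moreover have "e * z * P z - e * z * 0 + e * z * (1 - z) * - (Qinf ^ 3) = V z"
    unfolding V_def times_divide_eq_right[symmetric] e1 by (simp add: e_def)
  ultimately show ?thesis by simp
qed

lemma Phi_mult: "c (i + n) * y powi (i + n) * Phi (n, j) = c i * y powi i * (c j * (of_int (weight j n) * x i powi n))"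
proof -
  have "x i powi n = y powi n * q powi (i * n)"
    by (simp add: x_def power_int_mult_distrib power_int_mult)
  then show ?thesis
    unfolding Phi_def c_add power_int_add[OF disjI1[OF y_nz]] by simp
qed

text \<open>
  With \<open>k = i + n\<close>, \<open>Phi_mult\<close> turns the triple sum over \<open>(i, n, j)\<close> into the product of the triple
  product \<open>P y\<close> and the double series \<open>Phi\<close>, which no longer depends on \<open>y\<close>.
\<close>

lemma has_sum_V_total: "((\<lambda>i. c i * y powi i * V (x i)) has_sum P y * (2 * D)) UNIV"
proof -
  define F where "F = (\<lambda>(i, (n, j)). c i * y powi i * (c j * (of_int (weight j n) * x i powi n)))"
  have F_shift: "F (k - n, (n, j)) = c k * y powi k * Phi (n, j)" for k n j
    using Phi_mult[of "k - n" n j] by (simp add: F_def)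
  have "((\<lambda>(k, p). c k * y powi k * Phi p) has_sum P y * (2 * D)) (UNIV \<times> UNIV)"
    by (rule has_sum_product(1)[OF triple_product[OF y_nz] summable_c[OF y_nz] has_sum_Phi summable_Phi])
  also have "?this \<longleftrightarrow> (F has_sum P y * (2 * D)) (UNIV \<times> UNIV)"
    by (rule has_sum_reindex_bij_witness[where i = "\<lambda>(i, (n, j)). (i + n, (n, j))"
          and j = "\<lambda>(k, (n, j)). (k - n, (n, j))"])
      (use F_shift in auto)
  finally have F: "(F has_sum P y * (2 * D)) (UNIV \<times> UNIV)" .
  show ?thesis
  proof (rule has_sum_SigmaD[OF F])
    fix i
    have "(\<lambda>(i, p). F (i, p)) summable_on (UNIV \<times> UNIV)"
      using has_sum_imp_summable[OF F] by (simp only: case_prod_eta)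
    from summable_on_SigmaD1[OF this UNIV_I]
    obtain I where I: "((\<lambda>p. F (i, p)) has_sum I) (UNIV \<times> UNIV)"
      unfolding UNIV_Times_UNIV summable_on_def by blast
    \<comment> \<open>For fixed i the sum over n goes first: it is the Laurent polynomial
      \<open>weight_sum\<close>, and the sum over j then gives \<open>V (x i)\<close>.\<close>
    from has_sum_swap[THEN iffD1, OF this]
    have "((\<lambda>(j, n). F (i, (n, j))) has_sum I) (UNIV \<times> UNIV)" .
    then have "((\<lambda>j. c i * y powi i * (c j * weight_sum j (x i))) has_sum I) UNIV"
    proof (rule has_sum_SigmaD)
      show "((\<lambda>n. case (j, n) of (j, n) \<Rightarrow> F (i, n, j)) has_sum c i * y powi i * (c j * weight_sum j (x i))) UNIV" for j
        by (simp add: F_def) (intro has_sum_cmult_right has_sum_weight x_nz x_neq_1)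
    qed
    moreover have "((\<lambda>j. c i * y powi i * (c j * weight_sum j (x i))) has_sum c i * y powi i * V (x i)) UNIV"
      by (intro has_sum_cmult_right has_sum_V x_nz x_neq_1)
    ultimately have "I = c i * y powi i * V (x i)" by (rule has_sum_unique)
    with I show "((\<lambda>p. F (i, p)) has_sum c i * y powi i * V (x i)) UNIV"
      unfolding UNIV_Times_UNIV by (simp only:)
  qed
qed

section \<open>Convergence at both ends and evaluation of the sums S\<close>

lemma inverse_bounded:
  assumes "\<And>n. a * q ^ n \<noteq> 1"
  obtains B where "B > 0" "\<And>n. norm (1 / (1 - a * q ^ n)) \<le> B"
proof -
  have "(\<lambda>n. 1 / (1 - a * q ^ n)) \<longlonglongrightarrow> 1 / (1 - a * 0)"
    using norm_q by (intro tendsto_intros LIMSEQ_power_zero) auto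
  then have "Bseq (\<lambda>n. 1 / (1 - a * q ^ n))"
    by (intro convergent_imp_Bseq) (auto simp: convergent_def)
  then show thesis by (rule BseqE) (use that in auto)
qed

lemma x_nat: "x (int n) = y * q ^ n" and x_neg: "1 / x (- int n) = (1 / y) * q ^ n"
  by (simp_all add: x_def power_int_minus divide_simps)

text \<open>At the positive end \<open>x i\<close> tends to 0, at the negative end 1 /
  \<open>x i\<close> does; each denominator tends to 1 along its own half.\<close>

lemma x_bounded:
  obtains B where "B > 0" "\<And>n. norm (1 / (1 - x (int n))) \<le> B"
    "\<And>n. norm (1 / (1 - 1 / x (- int n))) \<le> B"
proof -
  have "y * q ^ n \<noteq> 1" for n
    using x_neq_1(1)[of "int n"] by (simp only: x_nat) simp
  then obtain B where B: "B > 0" "\<And>n. norm (1 / (1 - y * q ^ n)) \<le> B"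
    by (rule inverse_bounded) blast
  have "1 / y * q ^ n \<noteq> 1" for n
    unfolding x_neg[symmetric] using x_neq_1(1)[of "- int n"] by (simp add: field_simps)
  then obtain C where C: "C > 0" "\<And>n. norm (1 / (1 - 1 / y * q ^ n)) \<le> C"
    by (rule inverse_bounded) blast
  show thesis
    by (rule that[of "max B C"]) (use B C in \<open>simp_all only: x_nat x_neg less_max_iff_disj max.coboundedI1 max.coboundedI2 simp_thms\<close>)
qed

lemma summable_geometric_norm: "summable (\<lambda>n. C * norm (a * q ^ n))" for C :: real
  using norm_q by (auto simp: norm_mult norm_power intro!: summable_mult summable_geometric)

lemma summable_double_pole: "(\<lambda>i. norm (x i / (1 - x i) ^ 2)) summable_on UNIV"
proof -
  obtain B where B: "B > 0" "\<And>n. norm (1 / (1 - x (int n))) \<le> B"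
    "\<And>n. norm (1 / (1 - 1 / x (- int n))) \<le> B" by (rule x_bounded) blast
  have bound: "norm (z / (1 - z) ^ 2) \<le> B ^ 2 * norm z" if "norm (1 / (1 - z)) \<le> B" for z :: complex
  proof -
    have "norm (z / (1 - z) ^ 2) = norm (1 / (1 - z)) ^ 2 * norm z"
      by (simp add: norm_divide norm_power power_divide)
    also have "\<dots> \<le> B ^ 2 * norm z"
      using that by (intro mult_right_mono power_mono) auto
    finally show ?thesis .
  qed
  show ?thesis
  proof (rule norm_summable_on_int)
    show "summable (\<lambda>n. norm (x (int n) / (1 - x (int n)) ^ 2))"
      by (rule summable_comparison_test'[OF summable_geometric_norm[of "B ^ 2" y]])
        (use bound[OF B(2)] in \<open>simp add: x_nat\<close>)
    \<comment> \<open>z / (1 - z)^2 is invariant under inversion of z, so the negative half obeys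
      the same bound.\<close>
    have flip: "x i / (1 - x i) ^ 2 = (1 / x i) / (1 - 1 / x i) ^ 2" for i
    proof -
      have "(1 - 1 / x i) ^ 2 = (1 - x i) ^ 2 / x i ^ 2"
        by (simp add: field_simps power2_eq_square)
      then show ?thesis by (simp add: power2_eq_square)
    qed
    have "norm (x (- int n) / (1 - x (- int n)) ^ 2) \<le> B ^ 2 * norm (1 / y * q ^ n)" for n
      unfolding flip x_neg[symmetric] by (rule bound[OF B(3)])
    then show "summable (\<lambda>n. norm (x (- int n) / (1 - x (- int n)) ^ 2))"
      by (intro summable_comparison_test'[OF summable_geometric_norm[of "B ^ 2" "1 / y"]]) simp
  qed
qed

text \<open>
  \<open>1 / (1 - x i)\<close> tends to 1 and 0 at the two ends; subtracting the step function makes it summable.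
\<close>

definition step_part :: "int \<Rightarrow> complex" where
  "step_part i = 1 / (1 - x i) - (if i \<ge> 0 then 1 else 0)"

lemma summable_step_part: "(\<lambda>i. norm (step_part i)) summable_on UNIV"
proof -
  obtain B where B: "B > 0" "\<And>n. norm (1 / (1 - x (int n))) \<le> B"
    "\<And>n. norm (1 / (1 - 1 / x (- int n))) \<le> B" by (rule x_bounded) blast
  have bound: "norm (z / (1 - z)) \<le> B * norm z" if "norm (1 / (1 - z)) \<le> B" for z :: complex
  proof -
    have "norm (z / (1 - z)) = norm (1 / (1 - z)) * norm z"
      by (simp add: norm_divide)
    also have "\<dots> \<le> B * norm z"
      using that by (intro mult_right_mono) auto
    finally show ?thesis .
  qed
  show ?thesis
  proof (rule norm_summable_on_int)
    have pos: "step_part (int n) = x (int n) / (1 - x (int n))" for n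
      by (simp add: step_part_def field_simps)
    show "summable (\<lambda>n. norm (step_part (int n)))"
      by (rule summable_comparison_test'[OF summable_geometric_norm[of B y]])
        (use bound[OF B(2)] in \<open>simp add: pos x_nat\<close>)
    have neg: "step_part (- int n) = - ((1 / x (- int n)) / (1 - 1 / x (- int n)))" if "n \<ge> 1" for n
    proof -
      have "1 - 1 / x (- int n) = (x (- int n) - 1) / x (- int n)"
        by (simp add: diff_divide_distrib)
      then have "- ((1 / x (- int n)) / (1 - 1 / x (- int n))) = - (1 / (x (- int n) - 1))"
        by simp
      also have "\<dots> = 1 / (1 - x (- int n))"
        by (simp add: minus_divide_right)
      finally show ?thesis using that by (simp add: step_part_def)
    qed
    show "summable (\<lambda>n. norm (step_part (- int n)))"
    proof (rule summable_comparison_test'[OF summable_geometric_norm[of B "1 / y"]])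
      fix n :: nat assume "n \<ge> 1"
      then show "norm (norm (step_part (- int n))) \<le> B * norm (1 / y * q ^ n)"
        unfolding x_neg[symmetric] using bound[OF B(3)[of n]] by (simp only: neg norm_minus_cancel real_norm_def abs_norm_cancel)
    qed
  qed
qed

lemma has_sum_telescope: "((\<lambda>i. 1 / (1 - x i) - 1 / (1 - x (i - M))) has_sum of_int M) UNIV"
proof -
  \<comment> \<open>The difference of the two subtracted step functions. It is 1 at M places, or -1
    at |M| places if M < 0, so its sum is M in both cases.\<close>
  define h :: "int \<Rightarrow> complex" where "h i = (if i \<ge> 0 then 1 else 0) - (if i - M \<ge> 0 then 1 else 0)" for i
  have h: "(h has_sum of_int M) UNIV"
  proof (cases "M \<ge> 0")
    case True
    then show ?thesis
      by (intro has_sum_finite_neutralI[where B = "{0..<M}"]) (auto simp: h_def)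
  next
    case False
    then show ?thesis
      by (intro has_sum_finite_neutralI[where B = "{M..<0}"]) (auto simp: h_def)
  qed
  obtain T where T: "(step_part has_sum T) UNIV"
    using abs_summable_summable[OF summable_step_part] unfolding summable_on_def by blast
  then have "((\<lambda>i. step_part (i - M)) has_sum T) UNIV"
    using has_sum_int_shift[of step_part "- M" T] by simp
  from has_sum_add[OF has_sum_diff[OF T this] h] show ?thesis
    by (simp add: step_part_def h_def)
qed

definition S :: "nat \<Rightarrow> complex" where
  "S N = (\<Sum>\<^sub>\<infinity>i\<in>UNIV. 1 / ((1 - y * q powi i) * (1 - 1 / y * q powi (int N - 1 - i))))"

lemma q_powi_neq_1: "M \<noteq> 0 \<Longrightarrow> q powi M \<noteq> 1"
proof
  assume M: "M \<noteq> 0" and *: "q powi M = 1"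
  have "q ^ nat \<bar>M\<bar> = 1"
    using * by (cases "M \<ge> 0") (auto simp: power_int_def power_inverse)
  with one_minus_q_power_nz[of "nat \<bar>M\<bar>"] M show False by simp
qed

lemma S_eq:
  assumes "N \<noteq> 1"
  shows "S N = of_int (int N - 1) / (1 - q powi (int N - 1))"
proof -
  define M where "M = int N - 1"
  have Q1: "1 - q powi M \<noteq> 0" using assms q_powi_neq_1[of M] by (auto simp: M_def)
  have "1 / ((1 - y * q powi i) * (1 - 1 / y * q powi (int N - 1 - i)))
      = 1 / (1 - q powi M) * (1 / (1 - x i) - 1 / (1 - x (i - M)))" for i
  proof -
    define a b where "a = x i" and "b = x (i - M)"
    have ab: "a \<noteq> 0" "b \<noteq> 0" "a \<noteq> 1" "b \<noteq> 1" by (simp_all add: a_def b_def)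
    have Q: "q powi M = a / b"
      by (simp add: a_def b_def x_def power_int_diff)
    have "1 / y * q powi (int N - 1 - i) = 1 / b"
      unfolding M_def[symmetric] by (simp add: b_def x_def power_int_diff)
    moreover have "b \<noteq> a" using Q1 ab by (auto simp: Q)
    with ab have "1 / ((1 - a) * (1 - 1 / b)) = 1 / (1 - a / b) * (1 / (1 - a) - 1 / (1 - b))"
      by (simp add: divide_simps) (simp add: algebra_simps)
    ultimately show ?thesis
      by (simp only: Q a_def[symmetric] b_def[symmetric] x_def[symmetric])
  qed
  then have "((\<lambda>i. 1 / ((1 - y * q powi i) * (1 - 1 / y * q powi (int N - 1 - i))))
      has_sum (1 / (1 - q powi M) * of_int M)) UNIV"
    using has_sum_cmult_right[OF has_sum_telescope[of M], of "1 / (1 - q powi M)"] by (simp only:)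
  from infsumI[OF this] show ?thesis by (simp add: S_def M_def)
qed

text \<open>At N = 1 the two factors have the same zero in y, so partial fractions degenerate and a
  double pole replaces the telescoping difference.\<close>

lemma has_sum_S1: "((\<lambda>i. x i / (1 - x i) ^ 2) has_sum - S 1) UNIV"
proof -
  have "1 / ((1 - y * q powi i) * (1 - 1 / y * q powi (int 1 - 1 - i))) = - (x i / (1 - x i) ^ 2)" for i
  proof -
    have "1 / y * q powi (int 1 - 1 - i) = 1 / x i"
      by (simp add: x_def power_int_minus field_simps)
    moreover have "(1 - x i) * (1 - 1 / x i) = - ((1 - x i) ^ 2 / x i)"
      by (simp add: field_simps power2_eq_square)
    ultimately show ?thesis by (simp only: x_def[symmetric]) simp
  qed
  then have "S 1 = - (\<Sum>\<^sub>\<infinity>i. x i / (1 - x i) ^ 2)"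
    unfolding S_def by (simp only: infsum_uminus)
  with has_sum_infsum[OF abs_summable_summable[OF summable_double_pole]] show ?thesis by simp
qed

lemma appell_term:
  "c l * y powi l * (x l / (1 - x l)) = y * ((-1) powi l * y powi l * q powi (l * (l + 1) div 2) / (1 - y * q powi l))"
proof -
  have "l * (l + 1) div 2 = tri l + l"
    using tri_double[of l] by (simp add: algebra_simps)
  then show ?thesis by (simp add: c_def x_def power_int_add)
qed

lemma summable_appell: "(\<lambda>l. c l * y powi l * (x l / (1 - x l))) summable_on UNIV"
proof -
  obtain B where B: "B > 0" "\<And>n. norm (1 / (1 - x (int n))) \<le> B"
    "\<And>n. norm (1 / (1 - 1 / x (- int n))) \<le> B" by (rule x_bounded) blast
  have "norm (x l / (1 - x l)) \<le> 1 + B" for l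
  proof (cases l rule: int_cases2)
    case (nonneg n)
    have "x l / (1 - x l) = 1 / (1 - x l) - 1" by (simp add: field_simps)
    also have "norm \<dots> \<le> norm (1 / (1 - x l)) + norm (1 :: complex)" by (rule norm_triangle_ineq4)
    also have "\<dots> \<le> 1 + B" using B(2)[of n] nonneg by simp
    finally show ?thesis .
  next
    case (nonpos n)
    have "1 - 1 / x l = (x l - 1) / x l" by (simp add: diff_divide_distrib)
    then have "- (1 / (1 - 1 / x l)) = x l / (1 - x l)"
      by (simp add: minus_divide_right)
    then have "norm (x l / (1 - x l)) = norm (1 / (1 - 1 / x l))" by (metis norm_minus_cancel)
    also have "\<dots> \<le> 1 + B" using B(3)[of n] nonpos by simp
    finally show ?thesis .
  qed
  then have "norm (c l * y powi l * (x l / (1 - x l))) \<le> norm (c l * y powi l) * (1 + B)" for l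
    unfolding norm_mult by (intro mult_left_mono) auto
  then have "(\<lambda>l. norm (c l * y powi l * (x l / (1 - x l)))) summable_on UNIV"
    by (intro Infinite_Sum.abs_summable_on_comparison_test'[OF summable_on_cmult_left[OF summable_c[OF y_nz], of "1 + B"]]) auto
  then show ?thesis by (rule abs_summable_summable)
qed

definition appell :: complex where
  "appell = (\<Sum>\<^sub>\<infinity>l\<in>UNIV. (-1) powi l * y powi l * q powi (l * (l + 1) div 2) / (1 - y * q powi l))"

theorem appell_identity: "P y * (S 1 + 2 * D) + Qinf ^ 3 * y * appell = 0"
proof -
  have "(\<Sum>\<^sub>\<infinity>l. c l * y powi l * (x l / (1 - x l))) = y * appell"
    unfolding appell_term appell_def by (rule infsum_cmult_right')
  with has_sum_infsum[OF summable_appell]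
  have "((\<lambda>l. c l * y powi l * (x l / (1 - x l))) has_sum y * appell) UNIV" by simp
  from has_sum_diff[OF has_sum_cmult_right[OF has_sum_S1, of "P y"] has_sum_cmult_right[OF this, of "Qinf ^ 3"]]
  have "((\<lambda>i. P y * (x i / (1 - x i) ^ 2) - Qinf ^ 3 * (c i * y powi i * (x i / (1 - x i))))
      has_sum P y * - S 1 - Qinf ^ 3 * (y * appell)) UNIV" .
  \<comment> \<open>\<open>P_shift\<close> rewrites P y as \<open>c i * y powi i * P (x i)\<close>,
    which gives both pieces the same prefactor.\<close>
  moreover have "P y * (x i / (1 - x i) ^ 2) - Qinf ^ 3 * (c i * y powi i * (x i / (1 - x i)))
      = c i * y powi i * V (x i)" for i
    by (simp add: V_def P_shift[symmetric, of i] algebra_simps)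
  ultimately have "((\<lambda>i. c i * y powi i * V (x i)) has_sum P y * - S 1 - Qinf ^ 3 * (y * appell)) UNIV"
    by (simp only:)
  from has_sum_unique[OF this has_sum_V_total] show ?thesis
    by algebra
qed

end

section \<open>Summing the twined genus\<close>

text \<open>With r = s^2, one factor s^n absorbs n, and the other leaves the differentiated
  geometric series.\<close>

lemma summable_square_geometric:
  fixes r :: real
  assumes "0 \<le> r" "r < 1"
  shows "summable (\<lambda>n. (real n + 1) * real n * r ^ n)"
proof -
  define s where "s = sqrt r"
  have s: "norm s < 1" "s ^ 2 = r" "0 \<le> s" using assms by (auto simp: s_def real_sqrt_lt_1_iff)
  have "Bseq (\<lambda>n. real n * s ^ n)"
    using powser_times_n_limit_0[OF s(1)] by (intro convergent_imp_Bseq) (auto simp: convergent_def)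
  then obtain B where B: "\<And>n. norm (real n * s ^ n) \<le> B" by (auto simp: Bseq_def)
  have "summable (\<lambda>n. real (Suc n) * s ^ n)"
    using geometric_deriv_sums[OF s(1)] by (simp add: sums_iff)
  from summable_mult[OF this, of B]
  show ?thesis
  proof (rule summable_comparison_test'[where N = 0])
    fix n :: nat
    have "norm ((real n + 1) * real n * r ^ n) = norm (real n * s ^ n) * (real (Suc n) * s ^ n)"
      using s(3) assms by (simp add: s(2)[symmetric] abs_mult power_mult_distrib power2_eq_square mult_ac)
    also have "\<dots> \<le> B * (real (Suc n) * s ^ n)"
      using B[of n] s(3) by (intro mult_right_mono) auto
    finally show "norm ((real n + 1) * real n * r ^ n) \<le> B * (real (Suc n) * s ^ n)" .
  qed
qed

context nome
begin

text \<open>The Lambert terms of \<open>E2\<close>, see \<open>E2_eq\<close>. The value 0 at m = 0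
  lets every series start at 0.\<close>

definition t :: "nat \<Rightarrow> complex" where
  "t m = of_nat m * q ^ m / (1 - q ^ m)"

lemma t_0 [simp]: "t 0 = 0"
  by (simp add: t_def)

lemma summable_mult_t:
  assumes w: "\<And>n. norm (w n) \<le> C * (real n + 1)"
  shows "summable (\<lambda>n. w n * t n)"
proof -
  \<comment> \<open>The index is shifted because 1 - q^0 vanishes.\<close>
  have "(\<lambda>n. 1 / (1 - q ^ Suc n)) \<longlonglongrightarrow> 1 / (1 - 0)"
    using norm_q by (intro tendsto_intros LIMSEQ_Suc[OF LIMSEQ_power_zero]) auto
  then have "Bseq (\<lambda>n. 1 / (1 - q ^ Suc n))"
    by (intro convergent_imp_Bseq) (auto simp: convergent_def)
  then obtain B where B: "B > 0" "\<And>n. norm (1 / (1 - q ^ Suc n)) \<le> B"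
    by (rule BseqE) auto
  have "summable (\<lambda>n. (C * B) * ((real n + 1) * real n * norm q ^ n))"
    by (intro summable_mult summable_square_geometric) (use norm_q in auto)
  then show ?thesis
  proof (rule summable_comparison_test'[where N = 0])
    fix n :: nat
    have "norm (t n) \<le> B * (real n * norm q ^ n)"
    proof (cases n)
      case (Suc k)
      have "norm (t n) = norm (1 / (1 - q ^ n)) * (real n * norm q ^ n)"
        by (simp add: t_def norm_mult norm_divide norm_power)
      also have "\<dots> \<le> B * (real n * norm q ^ n)"
        using B(2)[of k] Suc by (intro mult_right_mono) auto
      finally show ?thesis .
    qed simp
    then have "norm (w n) * norm (t n) \<le> (C * (real n + 1)) * (B * (real n * norm q ^ n))"
      using w[of n] order_trans[OF norm_ge_zero w[of n]] by (intro mult_mono) auto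
    then show "norm (w n * t n) \<le> C * B * ((real n + 1) * real n * norm q ^ n)"
      by (simp add: norm_mult mult_ac)
  qed
qed

lemma summable_t: "summable t"
  using summable_mult_t[of "\<lambda>_. 1" 1] by simp

lemma summable_bounded_t: "(\<And>n. norm (w n) \<le> C) \<Longrightarrow> summable (\<lambda>n. w n * t n)"
proof (rule summable_mult_t)
  fix n assume w: "\<And>n. norm (w n) \<le> C"
  then have "0 \<le> C" using norm_ge_zero order_trans by blast
  then have "C * 1 \<le> C * (real n + 1)" by (intro mult_left_mono) auto
  with w[of n] show "norm (w n) \<le> C * (real n + 1)" by simp
qed

end

text \<open>Passing from n to n + 2 adds only the two outermost exponents; these increments are the
  power sums of the eigenvalue pair.\<close>

lemma chi_char_simps:
  assumes "l \<noteq> 0"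
  shows "chi_char 0 l = 1" "chi_char (Suc 0) l = l + inverse l"
    "chi_char (n + 2) l = chi_char n l + (l ^ (n + 2) + inverse l ^ (n + 2))"
proof -
  show "chi_char 0 l = 1" by (simp add: chi_char_def)
  show "chi_char (Suc 0) l = l + inverse l"
    by (simp add: chi_char_def power_int_minus)
  have "chi_char (n + 2) l = (\<Sum>i=0..Suc (Suc n). l powi (2 * int i - int (n + 2)))"
    by (simp add: chi_char_def)
  also have "\<dots> = l powi (- int (n + 2)) + (\<Sum>i=0..Suc n. l powi (2 * int (Suc i) - int (n + 2)))"
    by (subst sum.atLeast0_atMost_Suc_shift) simp
  also have "(\<Sum>i=0..Suc n. l powi (2 * int (Suc i) - int (n + 2)))
      = (\<Sum>i=0..n. l powi (2 * int i - int n)) + l powi int (n + 2)"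
    by (simp add: algebra_simps)
  finally show "chi_char (n + 2) l = chi_char n l + (l ^ (n + 2) + inverse l ^ (n + 2))"
    by (simp only: chi_char_def power_int_minus power_int_of_nat power_inverse add_ac)
qed

lemma norm_chi_char:
  assumes "norm l = 1"
  shows "norm (chi_char N l) \<le> real N + 1"
proof -
  have "norm (chi_char N l) \<le> (\<Sum>i=0..N. norm (l powi (2 * int i - int N)))"
    unfolding chi_char_def by (rule norm_sum)
  also have "\<dots> = real N + 1" using assms by (simp add: norm_power_int)
  finally show ?thesis .
qed

context nome_point
begin

text \<open>The cofactor of \<open>phi_m21\<close> in \<open>scriptF\<close>, see
  \<open>scriptF_eq\<close>.\<close>

definition T :: "nat \<Rightarrow> complex" where
  "T N = S N - 2 * S (N + 1) + 2 * S (N + 3) - S (N + 4)"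

lemma S_Suc: "m > 0 \<Longrightarrow> S (Suc m) = of_nat m + t m"
  using one_minus_q_power_nz[of m] by (simp add: S_eq t_def field_simps)

lemma S_0: "S 0 = t 1"
  using one_minus_q_power_nz[of 1] by (simp add: S_eq t_def power_int_minus field_simps)

text \<open>The constant is 2 * 2 - 3, from the linear parts of \<open>S 3\<close> and
  \<open>S 4\<close>; here they have no partner that cancels them.\<close>

lemma T_0: "T 0 = t 1 - 2 * S 1 + 1 + 2 * t 2 - t 3"
  using S_Suc[of 2] S_Suc[of 3] by (simp add: T_def S_0 numeral_eq_Suc)

lemma T_1: "T 1 = S 1 - 2 * t 1 + 2 * t 3 - t 4"
  using S_Suc[of 1] S_Suc[of 3] S_Suc[of 4] by (simp add: T_def numeral_eq_Suc)

text \<open>The linear parts n+1, n+2, n+4, n+5 cancel under the weights 1, -2, 2, -1.\<close>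

lemma T_plus_2: "T (n + 2) = t (n + 1) - 2 * t (n + 2) + 2 * t (n + 4) - t (n + 5)"
  using S_Suc[of "n + 1"] S_Suc[of "n + 2"] S_Suc[of "n + 4"] S_Suc[of "n + 5"]
  by (simp add: T_def numeral_eq_Suc)

theorem sums_T_chi_char:
  assumes l: "norm l = 1" "l \<noteq> 1"
  shows "(\<lambda>N. T N * (chi_char N l / ((1 - l) * (1 - inverse l)))) sums
    (1 / ((1 - l) * (1 - inverse l)) - S 1 - (\<Sum>m. (l ^ m + inverse l ^ m) * t m))"
proof -
  have l0: "l \<noteq> 0" using l by auto
  define p where "p m = l ^ m + inverse l ^ m" for m
  define d where "d = (1 - l) * (1 - inverse l)"
  have d0: "d \<noteq> 0" using l l0 by (auto simp: d_def)
  define X where "X N = chi_char N l / d" for N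
  \<comment> \<open>By \<open>p_rec\<close>, multiplying the sequence p by d is minus a second
    difference. This is why the differences of X in \<open>r1\<close> to \<open>r3\<close> are free
    of the denominator d.\<close>
  have dp: "d = 2 - p 1" using l0 by (simp add: d_def p_def algebra_simps)
  have p_rec: "p 1 * p (Suc m) = p (Suc (Suc m)) + p m" for m
  proof -
    have "(l + inverse l) * (l * a + inverse l * b) = l * (l * a) + inverse l * (inverse l * b) + (a + b)" for a b
      using right_inverse[OF l0] by algebra
    from this[of "l ^ m" "inverse l ^ m"] show ?thesis by (simp add: p_def)
  qed
  have X0: "d * X 0 = 1" and X1: "d * X 1 = p 1"
    using d0 l0 by (simp_all add: X_def chi_char_simps p_def)
  have X2: "d * X (n + 2) = d * X n + p (n + 2)" for n
    using d0 chi_char_simps(3)[OF l0, of n] by (simp add: X_def p_def)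
  have X_bound: "norm (X (f n)) \<le> 3 / norm d * (real n + 1)" if "f n \<le> n + 1" for f n
  proof -
    have "norm (chi_char (f n) l) \<le> 3 * (real n + 1)"
      using norm_chi_char[OF l(1), of "f n"] that by (auto intro: order_trans)
    then show ?thesis using d0 by (simp add: X_def norm_divide divide_right_mono)
  qed
  \<comment> \<open>The coefficients of \<open>t m\<close> after summation by parts: each f carries
    the index of X that meets \<open>t m\<close> in one of the four terms of
    \<open>T_plus_2\<close>.\<close>
  define f1 f2 f3 f4 fp where "f1 m = X (m + 1) * t m" and "f2 m = X m * t m"
    and "f3 m = X (m - 2) * t m" and "f4 m = X (m - 3) * t m" and "fp m = p m * t m" for m
  have summ: "summable f1" "summable f2" "summable f3" "summable f4"
    unfolding f1_def f2_def f3_def f4_def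
    by (rule summable_mult_t, rule X_bound[where f = "\<lambda>n. n + 1"], simp)
       (rule summable_mult_t, rule X_bound[where f = "\<lambda>n. n"], simp,
        rule summable_mult_t, rule X_bound[where f = "\<lambda>n. n - 2"], simp,
        rule summable_mult_t, rule X_bound[where f = "\<lambda>n. n - 3"], simp)
  have summp: "summable fp"
    unfolding fp_def
  proof (rule summable_bounded_t)
    show "norm (p n) \<le> 2" for n
      using norm_triangle_ineq[of "l ^ n" "inverse l ^ n"] l by (simp add: p_def norm_power norm_inverse)
  qed
  have X3: "d * X 3 = p 1 + p 3"
    using X2[of 1] X1 by (simp add: numeral_eq_Suc)
  have X2': "d * X 2 = 1 + p 2"
    using X2[of 0] X0 by (simp add: numeral_eq_Suc)
  have p2: "p 1 * p 1 = p 2 + 2" "p 1 * p 2 = p 3 + p 1"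
    using p_rec[of 0] p_rec[of 1] by (simp_all add: numeral_eq_Suc p_def)
  have r1: "X 2 - 2 * X 1 + X 0 = - p 1"
  proof -
    have "d * (X 2 - 2 * X 1 + X 0) = d * - p 1"
      using X0 X1 X2' p2 dp by algebra
    with d0 show ?thesis by (simp only: mult_cancel_left) simp
  qed
  have r2: "X 3 - 2 * X 2 + 2 * X 0 = - p 2"
  proof -
    have "d * (X 3 - 2 * X 2 + 2 * X 0) = d * - p 2"
      using X0 X3 X2' p2 dp by algebra
    with d0 show ?thesis by (simp only: mult_cancel_left) simp
  qed
  have r3: "X (n + 4) - 2 * X (n + 3) + 2 * X (n + 1) - X n = - p (n + 3)" for n
  proof -
    have "d * X (n + 4) = d * X n + p (n + 2) + p (n + 4)"
      using X2[of "n + 2"] X2[of n] by (simp add: numeral_eq_Suc)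
    moreover have "d * X (n + 3) = d * X (n + 1) + p (n + 3)"
      using X2[of "n + 1"] by (simp add: numeral_eq_Suc)
    moreover have "p 1 * p (n + 3) = p (n + 4) + p (n + 2)"
      using p_rec[of "n + 2"] by (simp add: numeral_eq_Suc)
    ultimately have "d * (X (n + 4) - 2 * X (n + 3) + 2 * X (n + 1) - X n) = d * - p (n + 3)"
      using dp by algebra
    with d0 show ?thesis by (simp only: mult_cancel_left) simp
  qed
  \<comment> \<open>By \<open>r3\<close>, e vanishes from m = 3 on. At m = 1 and m = 2 natural
    subtraction truncates m - 2 or m - 3 to 0, so these two values are found separately from
    \<open>r1\<close> and \<open>r2\<close>.\<close>
  define e where "e m = f1 m - 2 * f2 m + 2 * f3 m - f4 m + fp m" for m
  have e_sums: "e sums (suminf f1 - 2 * suminf f2 + 2 * suminf f3 - suminf f4 + suminf fp)"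
    unfolding e_def by (intro sums_add sums_diff sums_mult summable_sums summ summp)
  have "e m = 0" if "m \<notin> {1, 2}" for m
  proof (cases "m = 0")
    case True
    then show ?thesis by (simp add: e_def f1_def f2_def f3_def f4_def fp_def)
  next
    case False
    with that have "m = (m - 3) + 3" by auto
    then obtain n where n: "m = n + 3" by blast
    have "e m = (X (n + 4) - 2 * X (n + 3) + 2 * X (n + 1) - X n + p (n + 3)) * t m"
      by (simp add: e_def f1_def f2_def f3_def f4_def fp_def n algebra_simps numeral_eq_Suc)
    then show ?thesis by (simp only: r3) simp
  qed
  then have "e sums (\<Sum>m\<in>{1, 2}. e m)"
    by (intro sums_finite) auto
  with e_sums have sum_e: "suminf f1 - 2 * suminf f2 + 2 * suminf f3 - suminf f4 + suminf fp = e 1 + e 2"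
    using sums_unique2 by fastforce
  have e1: "e 1 = (X 2 - 2 * X 1 + 2 * X 0 - X 0 + p 1) * t 1" and
    e2: "e 2 = (X 3 - 2 * X 2 + 2 * X 0 - X 0 + p 2) * t 2"
    by (simp_all add: e_def f1_def f2_def f3_def f4_def fp_def algebra_simps numeral_eq_Suc)
  have shift: "(\<lambda>n. f1 (n + 1)) sums (suminf f1 - (\<Sum>i<1. f1 i))"
    "(\<lambda>n. f2 (n + 2)) sums (suminf f2 - (\<Sum>i<2. f2 i))"
    "(\<lambda>n. f3 (n + 4)) sums (suminf f3 - (\<Sum>i<4. f3 i))"
    "(\<lambda>n. f4 (n + 5)) sums (suminf f4 - (\<Sum>i<5. f4 i))"
    by (intro sums_split_initial_segment summable_sums summ)+
  define R where "R = suminf f1 - (\<Sum>i<1. f1 i) - 2 * (suminf f2 - (\<Sum>i<2. f2 i))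
      + 2 * (suminf f3 - (\<Sum>i<4. f3 i)) - (suminf f4 - (\<Sum>i<5. f4 i))"
  have "(\<lambda>n. f1 (n + 1) - 2 * f2 (n + 2) + 2 * f3 (n + 4) - f4 (n + 5)) sums R"
    unfolding R_def by (intro sums_add sums_diff sums_mult shift)
  moreover have "f1 (n + 1) - 2 * f2 (n + 2) + 2 * f3 (n + 4) - f4 (n + 5) = T (n + 2) * X (n + 2)" for n
    unfolding T_plus_2 f1_def f2_def f3_def f4_def by (simp add: algebra_simps)
  ultimately have "(\<lambda>n. T (n + 2) * X (n + 2)) sums R" by (simp only:)
  then have "(\<lambda>N. T N * X N) sums (R + (\<Sum>i<2. T i * X i))"
    by (rule sums_iff_shift[THEN iffD1])
  moreover have "R + (\<Sum>i<2. T i * X i) = 1 / d - S 1 - suminf fp"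
  proof -
    have fs: "(\<Sum>i<1. f1 i) = 0" "(\<Sum>i<2. f2 i) = X 1 * t 1"
      "(\<Sum>i<4. f3 i) = X 0 * t 1 + X 0 * t 2 + X 1 * t 3"
      "(\<Sum>i<5. f4 i) = X 0 * t 1 + X 0 * t 2 + X 0 * t 3 + X 1 * t 4"
      "(\<Sum>i<2. T i * X i) = T 0 * X 0 + T 1 * X 1"
      by (simp_all add: f1_def f2_def f3_def f4_def numeral_eq_Suc)
    \<comment> \<open>From d * X 1 = p 1 = 2 - d. It turns the coefficient -2 * X 0 + X 1 of
      \<open>S 1\<close> into -1.\<close>
    have x: "X 1 = 2 * X 0 - 1"
    proof -
      have "d * X 1 = d * (2 * X 0 - 1)" using X0 X1 dp by algebra
      with d0 show ?thesis by (simp only: mult_cancel_left) simp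
    qed
    have dX: "1 / d = X 0" using X0 d0 by (simp add: field_simps)
    have "X 2 - 2 * X 1 + 2 * X 0 - X 0 + p 1 = 0"
      using r1 by algebra
    then have "e 1 = 0" unfolding e1 by (simp only: mult_zero_left)
    moreover have "X 3 - 2 * X 2 + 2 * X 0 - X 0 + p 2 = - X 0"
      using r2 by algebra
    then have "e 2 = - X 0 * t 2" unfolding e2 by (simp only:)
    moreover have "suminf f1 = 2 * suminf f2 - 2 * suminf f3 + suminf f4 - suminf fp + (e 1 + e 2)"
      unfolding sum_e[symmetric] by simp
    ultimately have "suminf f1 = 2 * suminf f2 - 2 * suminf f3 + suminf f4 - suminf fp - X 0 * t 2"
      by simp
    then show ?thesis
      unfolding R_def fs T_0 T_1 x dX by (simp add: algebra_simps)
  qed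
  moreover have "fp = (\<lambda>m. (l ^ m + inverse l ^ m) * t m)"
    by (simp add: fun_eq_iff fp_def p_def)
  ultimately show ?thesis
    by (simp add: X_def d_def)
qed

end

section \<open>The classes\<close>

lemma zeta_power_eq_1: "n > 0 \<Longrightarrow> zeta n ^ k = 1 \<longleftrightarrow> n dvd k"
  using complex_root_unity_eq_1[of n k]
  by (simp add: zeta_def exp_of_nat_mult[symmetric] mult_ac)

lemma norm_zeta [simp]: "norm (zeta n) = 1"
  by (simp add: zeta_def norm_exp_eq_Re)

lemma zeta_nz [simp]: "zeta n \<noteq> 0"
  by (simp add: zeta_def)

lemma zeta_mult_power: "k > 0 \<Longrightarrow> zeta (n * k) ^ k = zeta n"
  by (simp add: zeta_def exp_of_nat_mult[symmetric])

lemma zeta_2: "zeta 2 = -1" and zeta_4: "zeta 4 = \<i>"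
  by (simp_all add: zeta_def exp_eq_polar cis_conv_exp[symmetric] complex_eq_iff)

lemma inverse_zeta: "n > 0 \<Longrightarrow> inverse (zeta n) = zeta n ^ (n - 1)"
  using zeta_power_eq_1[of n n] by (intro inverse_unique) (simp flip: power_Suc)

lemma sum_zeta_powers:
  assumes "n > 0"
  shows "(\<Sum>k<n. (zeta n ^ m) ^ k) = (if n dvd m then of_nat n else 0)"
proof (cases "n dvd m")
  case True
  then show ?thesis using zeta_power_eq_1[OF assms, of m] by simp
next
  case False
  then have "zeta n ^ m \<noteq> 1" using zeta_power_eq_1[OF assms, of m] by simp
  moreover have "(zeta n ^ m) ^ n = 1"
    using zeta_power_eq_1[OF assms, of "m * n"] by (simp add: power_mult)
  ultimately show ?thesis using False by (simp add: sum_gp_strict)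
qed

text \<open>For N > 0 this is the coefficient of \<open>t m\<close> in \<open>Lam N\<close>
  (\<open>Lam_eq\<close>), and equally N minus the m-th power sum of all N-th roots of
  unity.\<close>

definition nondiv :: "nat \<Rightarrow> nat \<Rightarrow> complex" where
  "nondiv N m = (if N dvd m then 0 else of_nat N)"

primrec T_coeff :: "aut_class \<Rightarrow> nat \<Rightarrow> complex" where
  "T_coeff C2A = (\<lambda>m. 16 * nondiv 2 m)"
| "T_coeff C3A = (\<lambda>m. 6 * nondiv 3 m)"
| "T_coeff C4B = (\<lambda>m. 4 * (- nondiv 2 m + nondiv 4 m))"
| "T_coeff C5A = (\<lambda>m. 2 * nondiv 5 m)"
| "T_coeff C6A = (\<lambda>m. 2 * (- nondiv 2 m - nondiv 3 m + nondiv 6 m))"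
| "T_coeff C7AB = (\<lambda>m. nondiv 7 m)"
| "T_coeff C8A = (\<lambda>m. - nondiv 4 m + nondiv 8 m)"

lemma sum_zeta_powers_nondiv:
  assumes "n > 0"
  shows "(\<Sum>k<n. (zeta n ^ m) ^ k) = of_nat n - nondiv n m"
  using sum_zeta_powers[OF assms] by (simp add: nondiv_def)

text \<open>For orders 4, 6 and 8 inclusion and exclusion over divisors isolates the primitive roots
  among all roots of unity; this is the origin of the mixed combinations in \<open>T_coeff\<close>.
  The term 2 * \<open>chi_K3 cl\<close> counts the eigenvalues.\<close>

lemma table_power_sum:
  "(\<Sum>M\<in>#eigenvalue_table cl. \<Sum>x\<in>#M. x ^ m) = 2 * of_nat (chi_K3 cl) - T_coeff cl m"
proof -
  have inv: "inverse (zeta n) ^ m = (zeta n ^ m) ^ (n - 1)" if "n > 0" for n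
    using inverse_zeta[OF that] by (simp add: power_mult[symmetric] mult.commute)
  have inv': "inverse (zeta n ^ k) ^ m = ((zeta n ^ m) ^ k) ^ (n - 1)" if "n > 0" for n k
  proof -
    have "inverse (zeta n ^ k) ^ m = (inverse (zeta n) ^ m) ^ k"
      by (simp only: power_inverse power_mult[symmetric] mult.commute)
    also have "\<dots> = ((zeta n ^ m) ^ k) ^ (n - 1)"
      unfolding inv[OF that] by (simp only: power_mult[symmetric] mult_ac)
    finally show ?thesis .
  qed
  have red: "w ^ (n + k) = w ^ k" if "w ^ n = 1" for w :: complex and n k
    using that by (simp add: power_add)
  have one: "(zeta n ^ m) ^ n = 1" if "n > 0" for n
    using zeta_power_eq_1[OF that, of "m * n"] by (simp add: power_mult)
  have pow: "(zeta n ^ k) ^ m = (zeta n ^ m) ^ k" for n k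
    by (simp only: power_mult[symmetric] mult.commute)
  have sub: "(zeta (n * k) ^ m) ^ k = zeta n ^ m" if "k > 0" for n k
    using zeta_mult_power[OF that, of n] pow[of "n * k" k] by simp
  note expand = eval_nat_numeral lessThan_Suc
  show ?thesis
  proof (cases cl)
    case C2A
    define w where "w = zeta 2 ^ m"
    have "1 + w = 2 - nondiv 2 m"
      using sum_zeta_powers_nondiv[of 2 m] by (simp add: w_def expand)
    then have "w = 1 - nondiv 2 m" by algebra
    then have "(-1) ^ m = 1 - nondiv 2 m" by (simp add: w_def zeta_2)
    then show ?thesis by (simp add: C2A eigenpair_def)
  next
    case C3A
    define w where "w = zeta 3 ^ m"
    have "1 + w + w ^ 2 = 3 - nondiv 3 m"
      using sum_zeta_powers_nondiv[of 3 m] by (simp add: w_def expand add_ac)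
    then have "w + w ^ 2 = 2 - nondiv 3 m" by algebra
    then show ?thesis using inv[of 3] by (simp add: C3A eigenpair_def w_def[symmetric])
  next
    case C4B
    define w where "w = zeta 4 ^ m"
    have "1 + w + w ^ 2 + w ^ 3 = 4 - nondiv 4 m"
      using sum_zeta_powers_nondiv[of 4 m] by (simp add: w_def expand add_ac)
    moreover have "1 + w ^ 2 = 2 - nondiv 2 m"
      using sum_zeta_powers_nondiv[of 2 m] sub[of 2 2] by (simp add: w_def expand)
    ultimately have "w + w ^ 3 = 2 - nondiv 4 m + nondiv 2 m" by algebra
    then show ?thesis using inv[of 4] unfolding C4B eigenvalue_table.simps zeta_4[symmetric]
      by (simp add: eigenpair_def w_def[symmetric])
  next
    case C5A
    define w where "w = zeta 5 ^ m"
    have s: "1 + w + w ^ 2 + w ^ 3 + w ^ 4 = 5 - nondiv 5 m"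
      using sum_zeta_powers_nondiv[of 5 m] by (simp add: w_def expand add_ac)
    \<comment> \<open>Inversion is the fourth power, whence 8 = 2 * 4, and \<open>red\<close> lowers
      it modulo 5. Orders 7 and 8 are treated alike.\<close>
    have "inverse (zeta 5 ^ 2) ^ m = w ^ 8" using inv'[of 5 2] by (simp add: w_def power_mult[symmetric] mult.commute)
    also have "\<dots> = w ^ 3" using red[OF one[of 5], of 3] by (simp add: w_def)
    finally have "(\<Sum>M\<in>#eigenvalue_table cl. \<Sum>x\<in>#M. x ^ m) = 2 * (w + w ^ 4) + 2 * (w ^ 2 + w ^ 3)"
      using inv[of 5] pow[of 5 2] by (simp add: C5A eigenpair_def w_def[symmetric])
    also have "\<dots> = 8 - 2 * nondiv 5 m" using s by algebra
    finally show ?thesis by (simp add: C5A)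
  next
    case C6A
    define w where "w = zeta 6 ^ m"
    have "1 + w + w ^ 2 + w ^ 3 + w ^ 4 + w ^ 5 = 6 - nondiv 6 m"
      using sum_zeta_powers_nondiv[of 6 m] by (simp add: w_def expand add_ac)
    moreover have "1 + w ^ 2 + (w ^ 2) ^ 2 = 3 - nondiv 3 m"
      using sum_zeta_powers_nondiv[of 3 m] sub[of 2 3] by (simp add: w_def expand add_ac)
    moreover have "1 + w ^ 3 = 2 - nondiv 2 m"
      using sum_zeta_powers_nondiv[of 2 m] sub[of 3 2] by (simp add: w_def expand)
    ultimately have "w + w ^ 5 = 2 - nondiv 6 m + nondiv 3 m + nondiv 2 m" by algebra
    then show ?thesis using inv[of 6] by (simp add: C6A eigenpair_def w_def[symmetric])
  next
    case C7AB
    define w where "w = zeta 7 ^ m"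
    have s: "1 + w + w ^ 2 + w ^ 3 + w ^ 4 + w ^ 5 + w ^ 6 = 7 - nondiv 7 m"
      using sum_zeta_powers_nondiv[of 7 m] by (simp add: w_def expand add_ac)
    have "inverse (zeta 7 ^ 2) ^ m = w ^ 12" using inv'[of 7 2] by (simp add: w_def power_mult[symmetric] mult.commute)
    also have "\<dots> = w ^ 5" using red[OF one[of 7], of 5] by (simp add: w_def)
    finally have 2: "inverse (zeta 7 ^ 2) ^ m = w ^ 5" .
    have "inverse (zeta 7 ^ 3) ^ m = w ^ 18" using inv'[of 7 3] by (simp add: w_def power_mult[symmetric] mult.commute)
    also have "\<dots> = w ^ 4" using red[OF one[of 7], of 11] red[OF one[of 7], of 4] by (simp add: w_def)
    finally have 3: "inverse (zeta 7 ^ 3) ^ m = w ^ 4" .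
    have "(\<Sum>M\<in>#eigenvalue_table cl. \<Sum>x\<in>#M. x ^ m) = w + w ^ 6 + (w ^ 2 + w ^ 5) + (w ^ 3 + w ^ 4)"
      using inv[of 7] pow[of 7 2] pow[of 7 3] 2 3 by (simp add: C7AB eigenpair_def w_def[symmetric] add_ac)
    also have "\<dots> = 6 - nondiv 7 m" using s by algebra
    finally show ?thesis by (simp add: C7AB)
  next
    case C8A
    define w where "w = zeta 8 ^ m"
    have s: "1 + w + w ^ 2 + w ^ 3 + w ^ 4 + w ^ 5 + w ^ 6 + w ^ 7 = 8 - nondiv 8 m"
      using sum_zeta_powers_nondiv[of 8 m] by (simp add: w_def expand add_ac)
    have s': "1 + w ^ 2 + (w ^ 2) ^ 2 + (w ^ 2) ^ 3 = 4 - nondiv 4 m"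
      using sum_zeta_powers_nondiv[of 4 m] sub[of 2 4] by (simp add: w_def expand add_ac)
    have "inverse (zeta 8 ^ 3) ^ m = w ^ 21" using inv'[of 8 3] by (simp add: w_def power_mult[symmetric] mult.commute)
    also have "\<dots> = w ^ 5" using red[OF one[of 8], of 13] red[OF one[of 8], of 5] by (simp add: w_def)
    finally have "(\<Sum>M\<in>#eigenvalue_table cl. \<Sum>x\<in>#M. x ^ m) = w + w ^ 7 + (w ^ 3 + w ^ 5)"
      using inv[of 8] pow[of 8 3] by (simp add: C8A eigenpair_def w_def[symmetric] add_ac)
    also have "\<dots> = 4 - nondiv 8 m + nondiv 4 m" using s s' by algebra
    finally show ?thesis by (simp add: C8A)
  qed
qed

lemma table_roots:
  assumes "M \<in># eigenvalue_table cl" "x \<in># M"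
  shows "norm x = 1" "x \<noteq> 1"
proof -
  obtain n k where x: "n > 0" "\<not> n dvd k" "x = zeta n ^ k \<or> x = inverse (zeta n ^ k)"
  proof (cases cl)
    case C2A
    then show thesis using assms that[of 2 1] by (auto simp: eigenpair_def zeta_2)
  next
    case C3A
    then show thesis using assms that[of 3 1] by (auto simp: eigenpair_def)
  next
    case C4B
    then show thesis using assms that[of 4 1] by (auto simp: eigenpair_def zeta_4)
  next
    case C5A
    then show thesis using assms that[of 5 1] that[of 5 2] by (auto simp: eigenpair_def)
  next
    case C6A
    then show thesis using assms that[of 6 1] by (auto simp: eigenpair_def)
  next
    case C7AB
    then show thesis using assms that[of 7 1] that[of 7 2] that[of 7 3] by (auto simp: eigenpair_def)
  next
    case C8A
    then show thesis using assms that[of 8 1] that[of 8 3] by (auto simp: eigenpair_def)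
  qed
  from x show "norm x = 1" by (auto simp: norm_power norm_inverse)
  from x show "x \<noteq> 1" using zeta_power_eq_1[of n k] by auto
qed

text \<open>The value is the trace on H^0 and H^2 of the structure sheaf predicted by the
  holomorphic Lefschetz formula; it is verified class by class. The product over the whole pair
  makes the summand independent of the chosen eigenvalue.\<close>

lemma table_holomorphic_lefschetz:
  "(\<Sum>M\<in>#eigenvalue_table cl. 1 / (\<Prod>x\<in>#M. 1 - x)) = 2"
proof -
  have sum0: "(\<Sum>k<n. zeta n ^ k) = 0" if "n > 1" for n
    using sum_zeta_powers[of n 1] that by simp
  have red: "zeta n ^ (n + k) = zeta n ^ k" if "n > 0" for n k
    using zeta_power_eq_1[OF that, of n] by (simp add: power_add)
  have inv': "inverse (zeta n ^ k) = (zeta n ^ k) ^ (n - 1)" if "n > 0" for n k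
    using inverse_zeta[OF that] by (simp add: power_inverse[symmetric] power_mult[symmetric] mult_ac)
  show ?thesis
  proof (cases cl)
    case C2A
    show ?thesis by (simp add: C2A eigenpair_def)
  next
    case C3A
    have "(1 - zeta 3) * (1 - inverse (zeta 3)) = 3"
      using sum0[of 3] inverse_zeta[of 3] zeta_power_eq_1[of 3 3]
      by (simp add: eval_nat_numeral lessThan_Suc algebra_simps)
    then show ?thesis by (simp add: C3A eigenpair_def)
  next
    case C4B
    have "(1 - \<i>) * (1 + \<i>) = 2" by (simp add: algebra_simps)
    then show ?thesis by (simp add: C4B eigenpair_def)
  next
    case C5A
    define A B where "A = (1 - zeta 5) * (1 - zeta 5 ^ 4)" and "B = (1 - zeta 5 ^ 2) * (1 - zeta 5 ^ 3)"
    have z: "zeta 5 ^ 4 + zeta 5 ^ 3 + zeta 5 ^ 2 + zeta 5 + 1 = 0"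
      using sum0[of 5] by (simp add: numeral_eq_Suc lessThan_Suc algebra_simps)
    \<comment> \<open>A * B is the fifth cyclotomic polynomial at 1; its value also shows that
      neither denominator vanishes.\<close>
    have AB: "A * B = 5" "A + B = 5" unfolding A_def B_def using z by algebra+
    have "A \<noteq> 0" "B \<noteq> 0" using AB(1) by auto
    then have "1 / A + 1 / B = (A + B) / (A * B)" by (simp add: field_simps)
    then have "1 / A + 1 / B = 1" using AB by simp
    moreover have "inverse (zeta 5 ^ 2) = zeta 5 ^ 3" "inverse (zeta 5) = zeta 5 ^ 4"
      using inv'[of 5 2] red[of 5 3] inverse_zeta[of 5] by (simp_all add: power_mult[symmetric])
    ultimately show ?thesis by (simp add: C5A eigenpair_def A_def B_def algebra_simps numeral_eq_Suc del: power_Suc)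
  next
    case C6A
    have "zeta 6 ^ 3 = -1" using zeta_mult_power[of 3 2] zeta_2 by simp
    moreover have "zeta 6 + 1 \<noteq> 0" using zeta_power_eq_1[of 6 2] by (auto simp: add_eq_0_iff2)
    moreover have "(zeta 6 + 1) * (zeta 6 ^ 2 - zeta 6 + 1) = zeta 6 ^ 3 + 1" by algebra
    ultimately have z: "zeta 6 ^ 2 - zeta 6 + 1 = 0" by simp
    have "(1 - zeta 6) * (1 - zeta 6 ^ 5) = 1" using z by algebra
    moreover have "inverse (zeta 6) = zeta 6 ^ 5" using inverse_zeta[of 6] by simp
    ultimately show ?thesis by (simp add: C6A eigenpair_def)
  next
    case C7AB
    define A B C where "A = (1 - zeta 7) * (1 - zeta 7 ^ 6)" and "B = (1 - zeta 7 ^ 2) * (1 - zeta 7 ^ 5)"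
      and "C = (1 - zeta 7 ^ 3) * (1 - zeta 7 ^ 4)"
    have z: "zeta 7 ^ 6 + zeta 7 ^ 5 + zeta 7 ^ 4 + zeta 7 ^ 3 + zeta 7 ^ 2 + zeta 7 + 1 = 0"
      using sum0[of 7] by (simp add: numeral_eq_Suc lessThan_Suc algebra_simps)
    have ABC: "A * B * C = 7" "A * B + B * C + A * C = 14"
      unfolding A_def B_def C_def using z by algebra+
    have "A \<noteq> 0" "B \<noteq> 0" "C \<noteq> 0" using ABC(1) by auto
    then have "1 / A + 1 / B + 1 / C = (A * B + B * C + A * C) / (A * B * C)" by (simp add: field_simps)
    then have "1 / A + 1 / B + 1 / C = 2" unfolding ABC by simp
    moreover have "inverse (zeta 7 ^ 2) = zeta 7 ^ 5" "inverse (zeta 7 ^ 3) = zeta 7 ^ 4" "inverse (zeta 7) = zeta 7 ^ 6"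
      using inv'[of 7 2] red[of 7 5] inv'[of 7 3] red[of 7 11] red[of 7 4] inverse_zeta[of 7]
      by (simp_all add: power_mult[symmetric])
    ultimately show ?thesis by (simp add: C7AB eigenpair_def A_def B_def C_def add.assoc)
  next
    case C8A
    define A B where "A = (1 - zeta 8) * (1 - zeta 8 ^ 7)" and "B = (1 - zeta 8 ^ 3) * (1 - zeta 8 ^ 5)"
    have z: "zeta 8 ^ 4 = -1" using zeta_mult_power[of 4 2] zeta_2 by simp
    have AB: "A * B = 2" "A + B = 4" unfolding A_def B_def using z by algebra+
    have "A \<noteq> 0" "B \<noteq> 0" using AB(1) by auto
    then have "1 / A + 1 / B = (A + B) / (A * B)" by (simp add: field_simps)
    then have "1 / A + 1 / B = 2" using AB by simp
    moreover have "inverse (zeta 8 ^ 3) = zeta 8 ^ 5" "inverse (zeta 8) = zeta 8 ^ 7"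
      using inv'[of 8 3] red[of 8 13] red[of 8 5] inverse_zeta[of 8] by (simp_all add: power_mult[symmetric])
    ultimately show ?thesis by (simp add: C8A eigenpair_def A_def B_def)
  qed
qed

section \<open>The twined genera\<close>

lemma ee_nz [simp]: "ee a \<noteq> 0"
  by (simp add: ee_def)

lemma ee_add: "ee (a + b) = ee a * ee b"
  by (simp add: ee_def distrib_left exp_add)

lemma ee_minus: "ee (- a) = inverse (ee a)"
  by (simp add: ee_def exp_minus)

lemma ee_of_nat_mult: "ee (of_nat n * a) = ee a ^ n"
  by (simp add: ee_def exp_of_nat_mult[symmetric] mult_ac)

lemma ee_of_int_mult: "ee (of_int n * a) = ee a powi n"
  by (simp add: ee_def exp_power_int mult_ac)

lemma ee_eq_1: "ee a = 1 \<longleftrightarrow> (\<exists>n::int. a = of_int n)"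
proof
  assume "ee a = 1"
  then obtain n :: int where "Re (2 * of_real pi * \<i> * a) = 0" "Im (2 * of_real pi * \<i> * a) = of_int (2 * n) * pi"
    unfolding ee_def exp_eq_1 by auto
  then have "a = of_int n" by (simp add: complex_eq_iff)
  then show "\<exists>n::int. a = of_int n" by blast
next
  assume "\<exists>n::int. a = of_int n"
  then show "ee a = 1" by (auto simp: ee_def exp_eq_1)
qed

lemma norm_ee_less_1: "Im \<tau> > 0 \<Longrightarrow> norm (ee \<tau>) < 1"
  by (simp add: ee_def norm_exp_eq_Re)

context nome_point
begin

section \<open>Translation of the special functions into q-series\<close>

context
  fixes \<tau> z :: complex
  assumes q: "ee \<tau> = q" and y: "ee z = y"
begin

lemma theta1_eq: "theta1 \<tau> z = \<i> * ee (\<tau> / 8) * inverse (ee (z / 2)) * P y"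
  by (simp add: theta1_def P_def q y ee_minus del: power_Suc)

lemma eta_eq: "eta \<tau> = ee (\<tau> / 24) * Qinf"
  by (simp add: eta_def Qinf_def q del: power_Suc)

lemma eta_nz: "eta \<tau> \<noteq> 0"
  by (simp add: eta_eq)

lemma eta_cube: "eta \<tau> ^ 3 = ee (\<tau> / 8) * Qinf ^ 3"
  using ee_of_nat_mult[of 3 "\<tau> / 24"] by (simp add: eta_eq power_mult_distrib)

lemma eta_power_6: "eta \<tau> ^ 6 = eta \<tau> ^ 3 * eta \<tau> ^ 3"
  by (simp flip: power_add)

lemma scriptF_eq: "scriptF N \<tau> z = phi_m21 \<tau> z * T N"
proof -
  have "s_fun N \<tau> z = theta1 \<tau> z / eta \<tau> ^ 3 * S N" for N
    by (simp add: s_fun_def S_def q y)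
  moreover have "- w * (w * a - 2 * (w * b) + 2 * (w * c) - w * d) = - (w ^ 2) * (a - 2 * b + 2 * c - d)"
    for w a b c d :: complex by algebra
  moreover have "(theta1 \<tau> z / eta \<tau> ^ 3) ^ 2 = theta1 \<tau> z ^ 2 / eta \<tau> ^ 6"
    by (simp add: power_divide flip: power_mult)
  ultimately show ?thesis
    by (simp only: scriptF_def phi_m21_def T_def)
qed

lemma F22_eq: "F22 \<tau> = - D"
  unfolding F22_def q using has_sum_F22 by (rule infsumI)

text \<open>The powers q^(1/8) of eta^3 and \<open>theta1\<close> cancel and the half powers of y
  combine to y, which leaves exactly the ratio in \<open>appell_identity\<close>.\<close>

lemma eta_cube_mu:
  assumes "P y \<noteq> 0"
  shows "eta \<tau> ^ 3 * mu \<tau> z = S 1 + 2 * D"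
proof -
  have h: "ee (z / 2) * ee (z / 2) = y"
    using ee_add[of "z / 2" "z / 2"] y by simp
  have "mu \<tau> z = (- \<i> * ee (z / 2)) / theta1 \<tau> z * appell"
    by (simp add: mu_def appell_def q y)
  also have "(- \<i> * ee (z / 2)) / theta1 \<tau> z = - (ee (z / 2) * ee (z / 2)) / (ee (\<tau> / 8) * P y)"
    using assms by (simp add: theta1_eq field_simps)
  finally have m: "mu \<tau> z = - (ee (z / 2) * ee (z / 2)) / (ee (\<tau> / 8) * P y) * appell" .
  have "eta \<tau> ^ 3 * mu \<tau> z = - (Qinf ^ 3 * (ee (z / 2) * ee (z / 2)) * appell) / P y"
    unfolding eta_cube m by simp
  also have "\<dots> = - (Qinf ^ 3 * y * appell) / P y"
    by (simp only: h)
  also have "- (Qinf ^ 3 * y * appell) = P y * (S 1 + 2 * D)"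
    using appell_identity by algebra
  finally show ?thesis using assms by simp
qed

text \<open>The term 48 * \<open>F22\<close> is what cancels the D brought in by \<open>mu\<close>.
  If \<open>P y\<close> vanishes, so does \<open>theta1\<close>, and both sides are 0.\<close>

lemma phi01_eq: "phi01 \<tau> z = phi_m21 \<tau> z * (- 12 * S 1 + E2 \<tau>)"
proof (cases "P y = 0")
  case True
  then show ?thesis by (simp add: phi01_def phi_m21_def theta1_eq)
next
  case False
  have "phi01 \<tau> z = 1 / 2 * (theta1 \<tau> z ^ 2 / eta \<tau> ^ 6) * (24 * (eta \<tau> ^ 3 * mu \<tau> z) + - 2 * E2 \<tau> + 48 * F22 \<tau>)"
  proof -
    have "1 / 2 * (a / e) * (24 * m + (b + f) / e) = 1 / 2 * (a / (e * e)) * (24 * (e * m) + b + f)"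
      if "e \<noteq> 0" for a e m b f :: complex
      using that by (simp add: field_simps)
    then show ?thesis
      unfolding phi01_def eta_power_6 using eta_nz power_not_zero by blast
  qed
  then have "phi01 \<tau> z = 1 / 2 * - phi_m21 \<tau> z * (24 * (S 1 + 2 * D) + - 2 * E2 \<tau> + 48 * - D)"
    unfolding eta_cube_mu[OF False] F22_eq phi_m21_def by simp
  then show ?thesis by (simp add: algebra_simps)
qed

lemma Flat_eq: "Flat \<tau> z = 2 * scriptF 0 \<tau> z"
proof (cases "P y = 0")
  case True
  then show ?thesis by (simp add: Flat_def scriptF_def theta1_eq)
next
  case False
  define r where "r = 2 * (1 + 2 * q + 6 * q ^ 2 + 2 * q ^ 3 + q ^ 4) / ((q - 1) * (q + 1) * (1 + q + q ^ 2))"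
  have "Flat \<tau> z = theta1 \<tau> z ^ 2 / eta \<tau> ^ 6 * (4 * (eta \<tau> ^ 3 * mu \<tau> z) + r + 8 * F22 \<tau>)"
  proof -
    have "4 * (a / e) * m + a / (e * e) * (b + f) = a / (e * e) * (4 * (e * m) + b + f)"
      if "e \<noteq> 0" for a e m b f :: complex
      using that by (simp add: field_simps)
    then show ?thesis
      unfolding Flat_def Let_def q r_def[symmetric] eta_power_6 using eta_nz power_not_zero by blast
  qed
  then have "Flat \<tau> z = - phi_m21 \<tau> z * (4 * (S 1 + 2 * D) + r + 8 * - D)"
    unfolding eta_cube_mu[OF False] F22_eq phi_m21_def by simp
  then have "Flat \<tau> z = phi_m21 \<tau> z * (- 4 * S 1 + - r)"
    by (simp add: algebra_simps)
  \<comment> \<open>The z-independent part of \<open>T 0\<close>; the common denominator of the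
    three Lambert terms is a * b * c, as 1 - q^2 and 1 - q^3 share the factor 1 - q.\<close>
  moreover have "- r = 2 * (t 1 + 1 + 2 * t 2 - t 3)"
  proof -
    define a b c where "a = q - 1" and "b = q + 1" and "c = 1 + q + q ^ 2"
    have f: "1 - q = - a" "1 - q ^ 2 = - (a * b)" "1 - q ^ 3 = - (a * c)"
      by (simp_all add: a_def b_def c_def power2_eq_square power3_eq_cube algebra_simps)
    have "- (a * b) \<noteq> 0" "- (a * c) \<noteq> 0"
      unfolding f[symmetric] by (simp_all only: one_minus_q_power_nz zero_less_numeral not_False_eq_True)
    then have nz: "a \<noteq> 0" "b \<noteq> 0" "c \<noteq> 0" by auto
    have "t 1 = - q / a" "t 2 = - (2 * q ^ 2) / (a * b)" "t 3 = - (3 * q ^ 3) / (a * c)"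
      by (simp_all add: t_def f)
    then have "2 * (t 1 + 1 + 2 * t 2 - t 3)
        = 2 * (- q * b * c + a * b * c - 4 * q ^ 2 * c + 3 * q ^ 3 * b) / (a * b * c)"
      using nz by (simp add: add_divide_distrib diff_divide_distrib)
    also have "2 * (- q * b * c + a * b * c - 4 * q ^ 2 * c + 3 * q ^ 3 * b)
        = - (2 * (1 + 2 * q + 6 * q ^ 2 + 2 * q ^ 3 + q ^ 4))"
      using a_def b_def c_def by algebra
    finally show ?thesis
      unfolding r_def a_def[symmetric] b_def[symmetric] c_def[symmetric] minus_divide_left by (rule sym)
  qed
  ultimately have "Flat \<tau> z = phi_m21 \<tau> z * (- 4 * S 1 + 2 * (t 1 + 1 + 2 * t 2 - t 3))"
    by (simp only:)
  then show ?thesis unfolding scriptF_eq T_0 by (simp add: algebra_simps)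
qed

lemma E2_eq: "E2 \<tau> = 1 - 24 * suminf t"
proof -
  have "(\<Sum>n. t (Suc n)) = suminf t"
    using suminf_split_head[OF summable_t] by simp
  then show ?thesis by (simp add: E2_def t_def q del: power_Suc of_nat_Suc)
qed

lemma summable_nondiv: "summable (\<lambda>m. nondiv N m * t m)"
  by (rule summable_bounded_t[where C = "real N"]) (simp add: nondiv_def)

text \<open>The Lambert series of E2 at N tau lives on the multiples of N, since
  \<open>t (N * k)\<close> is N times its k-th term; the difference cancels these m. The constant
  stems from the leading 1 of both series.\<close>

lemma Lam_eq:
  assumes "N > 0"
  shows "Lam N \<tau> = of_nat N * (of_nat N - 1) / 24 + (\<Sum>m. nondiv N m * t m)"
proof -
  define u where "u m = (if N dvd m then t m else 0)" for m
  have u: "(\<lambda>n. u (N * n)) = (\<lambda>n. t (N * n))" by (simp add: u_def)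
  have mono: "strict_mono (\<lambda>n. N * n)" using assms by (simp add: strict_mono_def)
  have zero: "u m = 0" if "m \<notin> range (\<lambda>n. N * n)" for m
    using that by (auto simp: u_def elim: dvdE)
  have summ_u: "summable u"
  proof -
    have "u = (\<lambda>m. (if N dvd m then 1 else 0) * t m)" by (auto simp: u_def)
    then show ?thesis by (simp only:) (rule summable_bounded_t[where C = 1], simp)
  qed
  have "summable (\<lambda>n. u (N * n)) \<longleftrightarrow> summable u"
    by (rule summable_mono_reindex[OF mono]) (rule zero)
  with summ_u have summ: "summable (\<lambda>n. t (N * n))" by (simp add: u)
  have "(\<Sum>n. u (N * n)) = suminf u"
    by (rule suminf_mono_reindex[OF mono]) (rule zero)
  then have sum: "(\<Sum>n. t (N * Suc n)) = suminf u"
    using suminf_split_head[OF summ] by (simp add: u)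
  define w where "w n = of_nat (Suc n) * ee (of_nat N * \<tau>) ^ Suc n / (1 - ee (of_nat N * \<tau>) ^ Suc n)" for n
  have tw: "t (N * Suc n) = of_nat N * w n" for n
    by (simp only: t_def w_def ee_of_nat_mult q power_mult of_nat_mult times_divide_eq_right mult.assoc)
  have "summable (\<lambda>n. t (N * Suc n))" using summ by (subst summable_Suc_iff)
  then have "summable w"
    using assms by (simp only: tw summable_cmult_iff) simp
  from suminf_mult[OF this, of "of_nat N"] have "suminf u = of_nat N * suminf w"
    unfolding tw[symmetric] sum .
  moreover have "E2 (of_nat N * \<tau>) = 1 - 24 * suminf w"
    by (simp only: E2_def w_def[abs_def])
  ultimately have E: "of_nat N * E2 (of_nat N * \<tau>) = of_nat N - 24 * suminf u"
    by (simp add: right_diff_distrib)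
  have "(\<lambda>m. nondiv N m * t m) = (\<lambda>m. of_nat N * (t m - u m))"
    by (auto simp: nondiv_def u_def)
  then have V: "(\<Sum>m. nondiv N m * t m) = of_nat N * (suminf t - suminf u)"
    using suminf_mult[OF summable_diff[OF summable_t summ_u], of "of_nat N"] suminf_diff[OF summable_t summ_u] by simp
  then show ?thesis
    unfolding Lam_def E E2_eq V by (simp add: field_simps)
qed

text \<open>In every class the constant term of \<open>T_tilde\<close> is 2 - chi / 12. The 2 will
  cancel the Euler characteristic of the structure sheaf, and chi / 12 is the constant term of chi /
  12 * E2.\<close>

lemma sums_T_coeff:
  "(\<lambda>m. T_coeff cl m * t m) sums (T_tilde cl \<tau> - 2 + of_nat (chi_K3 cl) / 12)"
proof -
  have s: "(\<lambda>m. nondiv N m * t m) sums (Lam N \<tau> - of_nat N * (of_nat N - 1) / 24)" if "N > 0" for N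
    using summable_sums[OF summable_nondiv[of N]] Lam_eq[OF that] by simp
  show ?thesis
  proof (cases cl)
    case C2A
    show ?thesis using sums_mult[OF s[of 2], of 16] by (simp add: C2A algebra_simps)
  next
    case C3A
    show ?thesis using sums_mult[OF s[of 3], of 6] by (simp add: C3A algebra_simps)
  next
    case C4B
    show ?thesis using sums_mult[OF sums_diff[OF s[of 4] s[of 2]], of 4]
      by (simp add: C4B algebra_simps)
  next
    case C5A
    show ?thesis using sums_mult[OF s[of 5], of 2] by (simp add: C5A algebra_simps)
  next
    case C6A
    show ?thesis using sums_mult[OF sums_diff[OF sums_diff[OF s[of 6] s[of 3]] s[of 2]], of 2]
      by (simp add: C6A algebra_simps)
  next
    case C7AB
    show ?thesis using s[of 7] by (simp add: C7AB algebra_simps)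
  next
    case C8A
    show ?thesis using sums_diff[OF s[of 8] s[of 4]] by (simp add: C8A algebra_simps)
  qed
qed

section \<open>Summation over the fixed points\<close>

context
  fixes A :: "'a set" and ev :: "'a \<Rightarrow> complex" and cl :: aut_class
  assumes fin: "finite A"
    and table: "image_mset (\<lambda>p. eigenpair (ev p)) (mset_set A) = eigenvalue_table cl"
begin

text \<open>A function of the unordered pair sees only the table, which removes the dependence on
  \<open>ev\<close>.\<close>

lemma sum_over_table: "(\<Sum>p\<in>A. F (eigenpair (ev p))) = (\<Sum>M\<in>#eigenvalue_table cl. F M)"
  unfolding table[symmetric] by (simp add: sum_unfold_sum_mset image_mset.compositionality o_def)

lemma ev_root: "p \<in> A \<Longrightarrow> norm (ev p) = 1 \<and> ev p \<noteq> 1"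
proof -
  assume "p \<in> A"
  then have "eigenpair (ev p) \<in># eigenvalue_table cl"
    unfolding table[symmetric] using fin by simp
  from table_roots[OF this, of "ev p"] show ?thesis by (simp add: eigenpair_def)
qed

lemma chi_structure_sheaf_eq: "chi_structure_sheaf A ev = 2"
  using sum_over_table[of "\<lambda>M. 1 / (\<Prod>x\<in>#M. 1 - x)"] table_holomorphic_lefschetz[of cl]
  by (simp add: chi_structure_sheaf_def eigenpair_def)

lemma card_eq: "card A = chi_K3 cl"
  using arg_cong[OF table, of size] by (simp add: size_eigenvalue_table)

lemma twined_Ell_eq:
  "twined_Ell A ev \<tau> z = 1 / 12 * of_nat (chi_K3 cl) * phi01 \<tau> z + T_tilde cl \<tau> * phi_m21 \<tau> z"
proof -
  define d where "d l = (1 - l) * (1 - inverse l)" for l :: complex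
  define p where "p l m = l ^ m + inverse l ^ m" for l :: complex and m
  have p_sum: "(\<lambda>m. p (ev a) m * t m) sums (\<Sum>m. p (ev a) m * t m)" if "a \<in> A" for a
  proof (rule summable_sums, rule summable_bounded_t)
    show "norm (p (ev a) m) \<le> 2" for m
      using norm_triangle_ineq[of "ev a ^ m" "inverse (ev a) ^ m"] ev_root[OF that]
      by (simp add: p_def norm_power norm_inverse)
  qed
  have "(\<lambda>m. \<Sum>a\<in>A. p (ev a) m * t m) sums (\<Sum>a\<in>A. \<Sum>m. p (ev a) m * t m)"
    by (rule sums_sum) (rule p_sum)
  moreover have "(\<Sum>a\<in>A. p (ev a) m * t m) = 2 * of_nat (chi_K3 cl) * t m - T_coeff cl m * t m" for m
    using sum_over_table[of "\<lambda>M. \<Sum>x\<in>#M. x ^ m"] table_power_sum[where cl = cl and m = m]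
    by (simp add: sum_distrib_right[symmetric] p_def eigenpair_def left_diff_distrib)
  ultimately have "(\<lambda>m. 2 * of_nat (chi_K3 cl) * t m - T_coeff cl m * t m) sums
      (\<Sum>a\<in>A. \<Sum>m. p (ev a) m * t m)"
    by (simp only:)
  then have "(\<Sum>a\<in>A. \<Sum>m. p (ev a) m * t m)
      = 2 * of_nat (chi_K3 cl) * suminf t - (T_tilde cl \<tau> - 2 + of_nat (chi_K3 cl) / 12)"
    by (rule sums_unique2) (intro sums_diff sums_mult summable_sums summable_t sums_T_coeff)
  moreover have "(\<Sum>a\<in>A. 1 / d (ev a)) = 2"
    using chi_structure_sheaf_eq by (simp add: chi_structure_sheaf_def d_def)
  moreover have "(\<Sum>a\<in>A. 1 / d (ev a) - S 1 - (\<Sum>m. p (ev a) m * t m))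
      = (\<Sum>a\<in>A. 1 / d (ev a)) - of_nat (chi_K3 cl) * S 1 - (\<Sum>a\<in>A. \<Sum>m. p (ev a) m * t m)"
    by (simp only: sum_subtractf sum_constant card_eq)
  ultimately have total: "(\<Sum>a\<in>A. 1 / d (ev a) - S 1 - (\<Sum>m. p (ev a) m * t m))
      = of_nat (chi_K3 cl) / 12 * (- 12 * S 1 + E2 \<tau>) + T_tilde cl \<tau>"
    unfolding E2_eq by (simp only:) (simp add: field_simps)
  have "(\<lambda>N. \<Sum>a\<in>A. phi_m21 \<tau> z * (T N * (chi_char N (ev a) / d (ev a)))) sums
      (\<Sum>a\<in>A. phi_m21 \<tau> z * (1 / d (ev a) - S 1 - (\<Sum>m. p (ev a) m * t m)))"
    unfolding d_def p_def by (intro sums_sum sums_mult sums_T_chi_char) (use ev_root in auto)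
  moreover have "(\<Sum>a\<in>A. phi_m21 \<tau> z * (T N * (chi_char N (ev a) / d (ev a))))
      = scriptF N \<tau> z * (\<Sum>a\<in>A. chi_char N (ev a) / ((1 - ev a) * (1 - inverse (ev a))))" for N
    by (simp add: scriptF_eq d_def sum_distrib_left mult.assoc)
  ultimately have "twined_Ell A ev \<tau> z = phi_m21 \<tau> z * (\<Sum>a\<in>A. 1 / d (ev a) - S 1 - (\<Sum>m. p (ev a) m * t m))"
    unfolding twined_Ell_def sum_distrib_left[symmetric] by (simp only: sums_unique[symmetric])
  then show ?thesis
    unfolding total phi01_eq by (simp add: algebra_simps)
qed

lemma twined_HEll_eq:
  "twined_HEll A ev \<tau> z \<nu> =
    1 / 12 * of_nat (chi_K3 cl) * phi01 \<tau> z + T_tilde cl \<tau> * phi_m21 \<tau> z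
    - (1 - 1 / 2 * (ee \<nu> + 1 / ee \<nu>)) * Flat \<tau> z"
  by (simp add: twined_HEll_def twined_Ell_eq chi_structure_sheaf_eq Flat_eq mult_ac)

end

end

end

theorem mainTheorem4:
  fixes X :: "'a::t2_space set" and \<A> :: "'a chart set" and g :: "'a \<Rightarrow> 'a"
    and ev :: "'a \<Rightarrow> complex" and c :: aut_class and \<tau> z \<nu> :: complex
  assumes "K3_surface X \<A>"
    and "symplectic_automorphism X \<A> g"
    and "has_order X g (class_order c)"
    and "has_fixed_point_data X \<A> g ev c"
    and "Im \<tau> > 0"
    and "\<And>m n :: int. z \<noteq> of_int m * \<tau> + of_int n"
  shows "twined_HEll (fixed_points X g) ev \<tau> z \<nu> =
    1 / 12 * of_nat (chi_K3 c) * phi01 \<tau> z + T_tilde c \<tau> * phi_m21 \<tau> z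
    - (1 - 1 / 2 * (ee \<nu> + 1 / ee \<nu>)) * Flat \<tau> z"
proof -
  \<comment> \<open>For z off the lattice, no denominator 1 - y q^k vanishes.\<close>
  interpret nome_point "ee \<tau>" "ee z"
  proof
    fix k :: int
    show "ee z * ee \<tau> powi k \<noteq> 1"
    proof
      assume "ee z * ee \<tau> powi k = 1"
      then have "ee (z + of_int k * \<tau>) = 1" by (simp add: ee_add ee_of_int_mult)
      then obtain n :: int where "z + of_int k * \<tau> = of_int n" by (auto simp: ee_eq_1)
      then have "z = of_int (- k) * \<tau> + of_int n" by (simp add: algebra_simps)
      with assms(6) show False by blast
    qed
  qed (use assms(5) norm_ee_less_1 in auto)
  from assms(4) show ?thesis
    unfolding has_fixed_point_data_def by (intro twined_HEll_eq) auto
qed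

end
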